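(* Let $D=(V,A)$ be a digraph (parallel arcs allowed) and $\mathcal{L}\subseteq 2^V$ a laminar family with $V\in\mathcal{L}$. Run the following procedure. (Phase 1) Set $D':=D$ and $\mathcal{L}':=\mathcal{L}$. While $\mathcal{L}'\neq\emptyset$: choose an inclusionwise minimal $F\in\mathcal{L}'$; choose any anchor node $a_F$ of the current digraph $D'[F]$; in $D'$ replace every arc $xy$ with $x\in F$, $y\notin F$ by the arc $a_Fy$; remove $F$ from $\mathcal{L}'$. Let $D'$ denote the final digraph. For each $a\in V$, let $D_a$ be obtained from $D'$ by replacing every arc $xy$ of $D'$ for which there is some $F\in\mathcal{L}$ with $a\in F$, $x\in F$, $y\notin F$, by the arc $ay$. (Phase 2) Output \[\mathrm{best}=\min_{F\in\mathcal{L}}\ \min\Big(\mu(D'[F]),\ \min_{a\in F}\mu(D_a[F])\Big).\] Then $\mathrm{best}=\gamma(D,\mathcal{L})$.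
   Context: A (spanning) arborescence of $D$ is a set $B\subseteq A$ which is a spanning tree in the undirected sense and in which every node has in-degree at most one; the node of in-degree $0$ is its root. $B$ is $\mathcal{L}$-tight if $|\delta^{in}_B(F)|\le 1$ for all $F\in\mathcal{L}$ and $|\delta^{in}_B(F)|=0$ for all $F\in\mathcal{L}$ containing the root of $B$. $\gamma(D,\mathcal{L})=\min\{|H|:H\subseteq A,\ D-H\text{ contains no }\mathcal{L}\text{-tight arborescence}\}$. For a digraph $G=(U,E)$, $\varrho_G(Z)$ is the number of arcs entering $Z$, and $\mu(G)=\min\{\varrho_G(Z_1)+\varrho_G(Z_2): Z_1,Z_2\subsetneq U\text{ non-empty},\ Z_1\cap Z_2=\emptyset\}$ (with $\min\emptyset=+\infty$). An anchor node of $G$ is a node $t\in U$ with $\varrho_G(Z)\ge\mu(G)/2$ for every non-empty $Z\subseteq U\setminus\{t\}$ (such a node always exists). $D[F]$ denotes the subdigraph induced by $F$. *)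

theory Defs
  imports "Graph_Theory.Digraph_Component" "HOL-Library.Extended_Nat"
begin

text \<open>
  The bidirected multigraph underlying a digraph: every arc \<open>e\<close> may be traversed forwards, as
  \<open>(e, True)\<close>, or backwards, as \<open>(e, False)\<close>.
\<close>

definition bidirect :: "('a, 'b) pre_digraph \<Rightarrow> ('a, 'b \<times> bool) pre_digraph" where
  "bidirect G = \<lparr> verts = verts G, arcs = arcs G \<times> UNIV,
     tail = (\<lambda>(e, fwd). if fwd then tail G e else head G e),
     head = (\<lambda>(e, fwd). if fwd then head G e else tail G e) \<rparr>"

text \<open>
  Tree in the undirected sense. The predicates \<^const>\<open>forest\<close> and \<^const>\<open>tree\<close> are not
  suitable here, since they only exclude directed cycles. A cycle of the underlying undirected
  multigraph uses every arc at most once, so that two parallel or two opposite arcs form a cycle,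
  but going back and forth along one arc does not. The predicate \<^const>\<open>connected\<close> already
  ignores the orientation of the arcs.
\<close>

definition undirected_tree :: "('a, 'b) pre_digraph \<Rightarrow> bool" where
  "undirected_tree G \<longleftrightarrow> connected G \<and>
     \<not> (\<exists>p. pre_digraph.cycle (bidirect G) p \<and> distinct (map fst p))"

definition arborescence :: "('a, 'b) pre_digraph \<Rightarrow> 'b set \<Rightarrow> bool" where
  "arborescence D B \<longleftrightarrow> B \<subseteq> arcs D \<and> undirected_tree (D\<lparr>arcs := B\<rparr>) \<and>
     (\<forall>v \<in> verts D. in_degree (D\<lparr>arcs := B\<rparr>) v \<le> 1)"

definition is_root :: "('a, 'b) pre_digraph \<Rightarrow> 'b set \<Rightarrow> 'a \<Rightarrow> bool" where
  "is_root D B r \<longleftrightarrow> r \<in> verts D \<and> in_degree (D\<lparr>arcs := B\<rparr>) r = 0"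

definition entering :: "('a, 'b) pre_digraph \<Rightarrow> 'a set \<Rightarrow> 'b set" where
  "entering G Z = {e \<in> arcs G. tail G e \<notin> Z \<and> head G e \<in> Z}"

definition \<rho> :: "('a, 'b) pre_digraph \<Rightarrow> 'a set \<Rightarrow> nat" where
  "\<rho> G Z = card (entering G Z)"

definition laminar :: "'a set set \<Rightarrow> bool" where
  "laminar L \<longleftrightarrow> (\<forall>X \<in> L. \<forall>Y \<in> L. X \<subseteq> Y \<or> Y \<subseteq> X \<or> X \<inter> Y = {})"

definition tight :: "('a, 'b) pre_digraph \<Rightarrow> 'a set set \<Rightarrow> 'b set \<Rightarrow> bool" where
  "tight D L B \<longleftrightarrow>
     (\<forall>F \<in> L. \<rho> (D\<lparr>arcs := B\<rparr>) F \<le> 1) \<and>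
     (\<forall>F \<in> L. (\<exists>r \<in> F. is_root D B r) \<longrightarrow> \<rho> (D\<lparr>arcs := B\<rparr>) F = 0)"

text \<open>
  The minima below are taken in \<^typ>\<open>enat\<close>, where the infimum of a non-empty set is attained and
  the infimum of the empty set is \<open>\<infinity>\<close>.
\<close>

definition \<gamma> :: "('a, 'b) pre_digraph \<Rightarrow> 'a set set \<Rightarrow> enat" where
  "\<gamma> D L = (INF H \<in> {H. H \<subseteq> arcs D \<and>
     \<not> (\<exists>B. arborescence (D\<lparr>arcs := arcs D - H\<rparr>) B \<and> tight (D\<lparr>arcs := arcs D - H\<rparr>) L B)}.
     enat (card H))"

definition \<mu> :: "('a, 'b) pre_digraph \<Rightarrow> enat" where
  "\<mu> G = (INF (Z1, Z2) \<in> {(Z1, Z2). Z1 \<noteq> {} \<and> Z1 \<subset> verts G \<and> Z2 \<noteq> {} \<and> Z2 \<subset> verts G \<and>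
     Z1 \<inter> Z2 = {}}. enat (\<rho> G Z1 + \<rho> G Z2))"

text \<open>The inequality \<open>\<rho>(Z) \<ge> \<mu>(G) / 2\<close> is multiplied by two, as \<^typ>\<open>enat\<close> has no division.\<close>

definition anchor :: "('a, 'b) pre_digraph \<Rightarrow> 'a \<Rightarrow> bool" where
  "anchor G t \<longleftrightarrow> t \<in> verts G \<and>
     (\<forall>Z. Z \<noteq> {} \<and> Z \<subseteq> verts G - {t} \<longrightarrow> 2 * enat (\<rho> G Z) \<ge> \<mu> G)"

text \<open>
  Replacing an arc by another one keeps its name and changes its tail, so that the multiplicities
  of parallel arcs are preserved.
\<close>

definition redirect :: "('a, 'b) pre_digraph \<Rightarrow> 'a set \<Rightarrow> 'a \<Rightarrow> ('a, 'b) pre_digraph" where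
  "redirect G F a =
     G\<lparr>tail := (\<lambda>e. if tail G e \<in> F \<and> head G e \<notin> F then a else tail G e)\<rparr>"

text \<open>
  \<open>phase1 D' L' D''\<close>: some sequence of choices of minimal sets and anchor nodes takes the current
  digraph \<open>D'\<close> and the current family \<open>L'\<close> to the final digraph \<open>D''\<close>.
\<close>

inductive phase1 :: "('a, 'b) pre_digraph \<Rightarrow> 'a set set \<Rightarrow> ('a, 'b) pre_digraph \<Rightarrow> bool" where
  stop: "phase1 D' {} D'"
| step: "phase1 D' L' D''"
    if "F \<in> L'" and "\<not> (\<exists>X \<in> L'. X \<subset> F)"
      and "anchor (D' \<restriction> F) a"
      and "phase1 (redirect D' F a) (L' - {F}) D''"

definition redirect_all :: "('a, 'b) pre_digraph \<Rightarrow> 'a set set \<Rightarrow> 'a \<Rightarrow> ('a, 'b) pre_digraph" where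
  "redirect_all G L a =
     G\<lparr>tail := (\<lambda>e. if \<exists>F \<in> L. a \<in> F \<and> tail G e \<in> F \<and> head G e \<notin> F then a else tail G e)\<rparr>"

definition best :: "('a, 'b) pre_digraph \<Rightarrow> 'a set set \<Rightarrow> enat" where
  "best D' L = (INF F \<in> L. min (\<mu> (D' \<restriction> F)) (INF a \<in> F. \<mu> (redirect_all D' L a \<restriction> F)))"

end

theory Submission
  imports Defs
begin

text \<open>
  A tight arborescence spans every \<open>X \<in> L\<close> from the single node at which \<open>X\<close> is entered, so moving the
  tails of its arcs that leave \<open>X\<close> to other nodes of \<open>X\<close> keeps it a tight arborescence. Hence \<open>D\<close>,
  \<open>D'\<close> and all \<open>D\<^sub>a\<close> have the same tight arborescences, and deleting the arcs that enter two
  disjoint non-empty sets in one of these digraphs destroys all of them; this gives \<open>\<gamma> \<le> best\<close>.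

  Conversely let \<open>H\<close> be a set of fewer than \<open>best\<close> arcs and let \<open>R X\<close> be the set of roots of tight
  arborescences of \<open>D[X] - H\<close>. If all arcs leaving the members \<open>X\<close> inside \<open>F\<close> have their tails in
  \<open>R X\<close>, then \<open>R F\<close> is empty only if there are two disjoint non-empty sets without entering arcs. Suppose
  that \<open>F\<close> is a minimal member with \<open>R F = {}\<close>, and call \<open>X \<subset> F\<close> bad if its anchor is not in \<open>R X\<close>.
  If \<open>X\<close> is a minimal bad set, the arcs of \<open>D'[X]\<close> entering \<open>R X\<close> lie in \<open>H\<close> and number at least
  \<open>\<mu>(D'[X]) / 2 \<ge> best / 2\<close>. Since a second such cut would exhaust \<open>H\<close>, all bad sets have a common root \<open>v\<close>.
  Then either \<open>v\<close> is a root of all members containing it, and \<open>D\<^sub>v[F]\<close> has two disjoint sets without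
  entering arcs, or \<open>v\<close> is not a root of some of them, which shields the rest of \<open>F\<close> from the bad sets,
  and \<open>D'[F]\<close> has two such sets.
\<close>

section \<open>Tight arborescences and changes of tails\<close>

text \<open>Heads and tails are separate parameters because the digraphs of the procedure differ in
  their tails only. Spanning is expressed by cuts, the form that is easiest to compare with the cuts
  counted by \<open>\<mu>\<close>.\<close>

definition tight_arb :: "'a set set \<Rightarrow> ('b \<Rightarrow> 'a) \<Rightarrow> ('b \<Rightarrow> 'a) \<Rightarrow> 'a set \<Rightarrow> 'b set \<Rightarrow> 'a \<Rightarrow> bool" where
  "tight_arb L h t F B r \<longleftrightarrow> r \<in> F \<and> (\<forall>e\<in>B. t e \<in> F \<and> h e \<in> F \<and> h e \<noteq> r) \<and> inj_on h B \<and>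
     (\<forall>Z. Z \<noteq> {} \<and> Z \<subseteq> F - {r} \<longrightarrow> (\<exists>e\<in>B. t e \<notin> Z \<and> h e \<in> Z)) \<and>
     (\<forall>X\<in>L. X \<subseteq> F \<longrightarrow>
        (\<forall>e\<in>B. t e \<notin> X \<longrightarrow> h e \<in> X \<longrightarrow> r \<notin> X \<and> (\<forall>e'\<in>B. t e' \<notin> X \<longrightarrow> h e' \<in> X \<longrightarrow> e' = e)))"

lemma tight_arbD:
  assumes "tight_arb L h t F B r"
  shows "r \<in> F"
    and "e \<in> B \<Longrightarrow> t e \<in> F" and "e \<in> B \<Longrightarrow> h e \<in> F" and "e \<in> B \<Longrightarrow> h e \<noteq> r"
    and "inj_on h B"
    and "Z \<noteq> {} \<Longrightarrow> Z \<subseteq> F - {r} \<Longrightarrow> \<exists>e\<in>B. t e \<notin> Z \<and> h e \<in> Z"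
    and "X \<in> L \<Longrightarrow> X \<subseteq> F \<Longrightarrow> e \<in> B \<Longrightarrow> t e \<notin> X \<Longrightarrow> h e \<in> X \<Longrightarrow> r \<notin> X"
    and "X \<in> L \<Longrightarrow> X \<subseteq> F \<Longrightarrow> e \<in> B \<Longrightarrow> t e \<notin> X \<Longrightarrow> h e \<in> X \<Longrightarrow>
      e' \<in> B \<Longrightarrow> t e' \<notin> X \<Longrightarrow> h e' \<in> X \<Longrightarrow> e' = e"
  using assms unfolding tight_arb_def by blast+

lemma tight_arbI:
  assumes "r \<in> F"
    and "\<And>e. e \<in> B \<Longrightarrow> t e \<in> F \<and> h e \<in> F \<and> h e \<noteq> r"
    and "inj_on h B"
    and "\<And>Z. Z \<noteq> {} \<Longrightarrow> Z \<subseteq> F - {r} \<Longrightarrow> \<exists>e\<in>B. t e \<notin> Z \<and> h e \<in> Z"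
    and "\<And>X e. X \<in> L \<Longrightarrow> X \<subseteq> F \<Longrightarrow> e \<in> B \<Longrightarrow> t e \<notin> X \<Longrightarrow> h e \<in> X \<Longrightarrow> r \<notin> X"
    and "\<And>X e e'. X \<in> L \<Longrightarrow> X \<subseteq> F \<Longrightarrow> e \<in> B \<Longrightarrow> t e \<notin> X \<Longrightarrow> h e \<in> X \<Longrightarrow>
      e' \<in> B \<Longrightarrow> t e' \<notin> X \<Longrightarrow> h e' \<in> X \<Longrightarrow> e' = e"
  shows "tight_arb L h t F B r"
  unfolding tight_arb_def by (intro conjI ballI allI impI) (use assms in metis)+

text \<open>Injectivity of the heads and the absence of arcs into \<open>r\<close> are just
  tightness at singletons, so nodes may be treated as members of the family.\<close>

lemma tight_arb_insert_singletons:
  "tight_arb (L \<union> (\<lambda>v. {v}) ` V) h t F B r \<longleftrightarrow> tight_arb L h t F B r"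
proof
  assume T: "tight_arb L h t F B r"
  show "tight_arb (L \<union> (\<lambda>v. {v}) ` V) h t F B r"
  proof (rule tight_arbI)
    fix X e assume "X \<in> L \<union> (\<lambda>v. {v}) ` V" "X \<subseteq> F" "e \<in> B" "t e \<notin> X" "h e \<in> X"
    then show "r \<notin> X" using tight_arbD(4,7)[OF T] by blast
  next
    fix X e e' assume X: "X \<in> L \<union> (\<lambda>v. {v}) ` V" "X \<subseteq> F" "e \<in> B" "t e \<notin> X" "h e \<in> X"
      and e': "e' \<in> B" "t e' \<notin> X" "h e' \<in> X"
    show "e' = e"
    proof (cases "X \<in> L")
      case True
      then show ?thesis using tight_arbD(8)[OF T True X(2-5) e'] by blast
    next
      case False
      then have "h e' = h e" using X e' by blast
      then show ?thesis using tight_arbD(5)[OF T] X(3) e'(1) by (auto dest: inj_onD)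
    qed
  qed (use tight_arbD[OF T] in blast)+
next
  assume T: "tight_arb (L \<union> (\<lambda>v. {v}) ` V) h t F B r"
  show "tight_arb L h t F B r"
    by (rule tight_arbI; (rule tight_arbD[OF T])?) (use tight_arbD(2-4,7,8)[OF T] in auto)
qed

lemma tight_arb_singleton: "tight_arb L h t {v} {} v"
  unfolding tight_arb_def by auto

text \<open>If \<open>r\<close> lies in \<open>X\<close>, no arc of \<open>B\<close> enters
  \<open>X\<close>; otherwise exactly one does, and its head becomes the root. In both cases a set
  inside \<open>X\<close> that avoids the root is entered by an arc whose tail lies in
  \<open>X\<close>.\<close>

lemma tight_arb_restrict:
  assumes T: "tight_arb L h t F B r" and X: "X \<in> L" "X \<subseteq> F" "X \<noteq> {}"
  obtains r' where "tight_arb L h t X {e \<in> B. t e \<in> X \<and> h e \<in> X} r'" "r \<in> X \<Longrightarrow> r' = r"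
proof (cases "r \<in> X")
  case True
  have "tight_arb L h t X {e \<in> B. t e \<in> X \<and> h e \<in> X} r"
  proof (rule tight_arbI)
    fix Z assume "Z \<noteq> {}" "Z \<subseteq> X - {r}"
    then obtain e where "e \<in> B" "t e \<notin> Z" "h e \<in> Z"
      using tight_arbD(6)[OF T, of Z] X by blast
    then show "\<exists>e\<in>{e \<in> B. t e \<in> X \<and> h e \<in> X}. t e \<notin> Z \<and> h e \<in> Z"
      using tight_arbD(7)[OF T X(1,2), of e] True \<open>Z \<subseteq> X - {r}\<close> by blast
  next
    show "inj_on h {e \<in> B. t e \<in> X \<and> h e \<in> X}"
      using tight_arbD(5)[OF T] by (rule inj_on_subset) auto
  next
    fix Y e e'
    assume Y: "Y \<in> L" "Y \<subseteq> X" "e \<in> {e \<in> B. t e \<in> X \<and> h e \<in> X}" "t e \<notin> Y" "h e \<in> Y"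
      "e' \<in> {e \<in> B. t e \<in> X \<and> h e \<in> X}" "t e' \<notin> Y" "h e' \<in> Y"
    show "e' = e"
      using tight_arbD(8)[OF T Y(1), of e e'] X Y by auto
  qed (use True X tight_arbD(4,7)[OF T] in auto)
  then show ?thesis using that by blast
next
  case False
  then obtain e0 where e0: "e0 \<in> B" "t e0 \<notin> X" "h e0 \<in> X"
    using tight_arbD(6)[OF T, of X] X by blast
  have "tight_arb L h t X {e \<in> B. t e \<in> X \<and> h e \<in> X} (h e0)"
  proof (rule tight_arbI)
    fix Z assume "Z \<noteq> {}" "Z \<subseteq> X - {h e0}"
    then obtain e where "e \<in> B" "t e \<notin> Z" "h e \<in> Z"
      using tight_arbD(6)[OF T, of Z] X False by blast
    then show "\<exists>e\<in>{e \<in> B. t e \<in> X \<and> h e \<in> X}. t e \<notin> Z \<and> h e \<in> Z"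
      using tight_arbD(8)[OF T X(1,2) e0, of e] \<open>Z \<subseteq> X - {h e0}\<close> by blast
  next
    fix Y e assume Y: "Y \<in> L" "Y \<subseteq> X" "e \<in> {e \<in> B. t e \<in> X \<and> h e \<in> X}" "t e \<notin> Y" "h e \<in> Y"
    show "h e0 \<notin> Y"
      using tight_arbD(8)[OF T Y(1), of e e0] X Y e0 by auto
  next
    fix Y e e'
    assume Y: "Y \<in> L" "Y \<subseteq> X" "e \<in> {e \<in> B. t e \<in> X \<and> h e \<in> X}" "t e \<notin> Y" "h e \<in> Y"
      "e' \<in> {e \<in> B. t e \<in> X \<and> h e \<in> X}" "t e' \<notin> Y" "h e' \<in> Y"
    show "e' = e"
      using tight_arbD(8)[OF T Y(1), of e e'] X Y by auto
  next
    show "inj_on h {e \<in> B. t e \<in> X \<and> h e \<in> X}"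
      using tight_arbD(5)[OF T] by (rule inj_on_subset) auto
  qed (use e0 tight_arbD(5)[OF T] in \<open>auto dest: inj_onD\<close>)
  then show ?thesis using that False by blast
qed

lemma tight_arb_no_disjoint_closed:
  assumes T: "tight_arb L h t F B r" and "Z1 \<noteq> {}" "Z2 \<noteq> {}" "Z1 \<subseteq> F" "Z2 \<subseteq> F" "Z1 \<inter> Z2 = {}"
  shows "\<exists>e\<in>B. t e \<notin> Z1 \<and> h e \<in> Z1 \<or> t e \<notin> Z2 \<and> h e \<in> Z2"
proof -
  have "r \<notin> Z1 \<or> r \<notin> Z2" using assms by blast
  then show ?thesis using tight_arbD(6)[OF T, of Z1] tight_arbD(6)[OF T, of Z2] assms(2-) by blast
qed

text \<open>\<open>B\<close> spans \<open>X\<close> from \<open>r\<close> or from the one node where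
  \<open>X\<close> is entered, so the leaving arcs may start at any node of
  \<open>X\<close>.\<close>

lemma tight_arb_change_tails_leaving:
  assumes T: "tight_arb L h t F B r" and L: "laminar L" "F \<in> L" "X \<in> L"
    and t': "\<And>e. e \<in> B \<Longrightarrow> t' e = t e \<or> t e \<in> X \<and> t' e \<in> X \<and> h e \<notin> X"
  shows "tight_arb L h t' F B r"
proof (cases "X \<subseteq> F")
  case False
  then have "F \<subseteq> X \<or> X \<inter> F = {}" using L unfolding laminar_def by blast
  then have "t' e = t e" if "e \<in> B" for e
    using t'[OF that] tight_arbD(2,3)[OF T that] by blast
  then show ?thesis using T unfolding tight_arb_def by simp
next
  case True
  \<comment> \<open>A moved arc with head in \<open>Y\<close> leaves \<open>X\<close>, so
    \<open>Y\<close> is not contained in \<open>X\<close>; by laminarity its old and new tails lie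
    on the same side of \<open>Y\<close>.\<close>
  have same: "t' e \<in> Y \<longleftrightarrow> t e \<in> Y" if "e \<in> B" "Y \<in> L" "h e \<in> Y" for e Y
  proof (cases "t' e = t e")
    case False
    then have "t e \<in> X" "t' e \<in> X" "h e \<notin> X" using t'[OF that(1)] by auto
    moreover have "X \<subseteq> Y \<or> Y \<subseteq> X \<or> X \<inter> Y = {}" using L that(2) unfolding laminar_def by blast
    ultimately show ?thesis using that(3) by blast
  qed simp
  show ?thesis
  proof (rule tight_arbI)
    fix Z assume Z: "Z \<noteq> {}" "Z \<subseteq> F - {r}"
    show "\<exists>e\<in>B. t' e \<notin> Z \<and> h e \<in> Z"
    proof (cases "Z \<inter> X = {}")
      case True
      obtain e where "e \<in> B" "t e \<notin> Z" "h e \<in> Z" using tight_arbD(6)[OF T Z] by blast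
      then show ?thesis using t'[of e] True by (intro bexI[of _ e]) auto
    next
      case False
      then obtain e0 where e0: "e0 \<in> B" "t e0 \<notin> Z \<inter> X" "h e0 \<in> Z \<inter> X"
        using tight_arbD(6)[OF T, of "Z \<inter> X"] Z by blast
      show ?thesis
      proof (cases "t e0 \<in> Z")
        case False
        then show ?thesis using e0 t'[OF e0(1)] by (intro bexI[of _ e0]) auto
      next
        case True
        \<comment> \<open>Now \<open>e0\<close> enters \<open>X\<close> from \<open>Z\<close> and is
          the only arc entering \<open>X\<close>. An arc entering \<open>Z \<union> X\<close> is a
          different one, so its head lies in \<open>Z\<close> outside \<open>X\<close>.\<close>
        then have t0: "t e0 \<notin> X" using e0 by blast
        then have "r \<notin> X" using tight_arbD(7)[OF T L(3) \<open>X \<subseteq> F\<close> e0(1)] e0 by blast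
        then obtain e1 where e1: "e1 \<in> B" "t e1 \<notin> Z \<union> X" "h e1 \<in> Z \<union> X"
          using tight_arbD(6)[OF T, of "Z \<union> X"] Z \<open>X \<subseteq> F\<close> by blast
        have "h e1 \<in> Z"
          using tight_arbD(8)[OF T L(3) \<open>X \<subseteq> F\<close> e0(1) t0, of e1] e0 e1 by blast
        then show ?thesis using e1 t'[OF e1(1)] by (intro bexI[of _ e1]) auto
      qed
    qed
  next
    fix Y e assume Y: "Y \<in> L" "Y \<subseteq> F" "e \<in> B" "t' e \<notin> Y" "h e \<in> Y"
    then show "r \<notin> Y" using tight_arbD(7)[OF T Y(1-3)] same[OF Y(3,1,5)] by simp
  next
    fix Y e e'
    assume Y: "Y \<in> L" "Y \<subseteq> F" "e \<in> B" "t' e \<notin> Y" "h e \<in> Y" "e' \<in> B" "t' e' \<notin> Y" "h e' \<in> Y"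
    then show "e' = e"
      using tight_arbD(8)[OF T Y(1-3) _ Y(5,6) _ Y(8)] same[OF Y(3,1,5)] same[OF Y(6,1,8)] by blast
  next
    fix e assume e: "e \<in> B"
    show "t' e \<in> F \<and> h e \<in> F \<and> h e \<noteq> r"
      using tight_arbD(2-4)[OF T e] t'[OF e] \<open>X \<subseteq> F\<close> by auto
  qed (use tight_arbD(1,5)[OF T] in auto)
qed

text \<open>Each arc may use a member of its own. This makes the relation symmetric and, for laminar
  families, transitive, so that it compares all tails arising in the procedure.\<close>

definition retail :: "'a set set \<Rightarrow> ('b \<Rightarrow> 'a) \<Rightarrow> ('b \<Rightarrow> 'a) \<Rightarrow> ('b \<Rightarrow> 'a) \<Rightarrow> bool" where
  "retail L h t t' \<longleftrightarrow> (\<forall>e. t' e = t e \<or> (\<exists>X\<in>L. t e \<in> X \<and> t' e \<in> X \<and> h e \<notin> X))"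

lemma retail_sym: "retail L h t t' \<Longrightarrow> retail L h t' t"
  unfolding retail_def by metis

text \<open>The two members share the tail \<open>t' e\<close>, hence are nested, and the larger one
  is a witness for the composition.\<close>

lemma retail_trans:
  assumes "laminar L" "retail L h t t'" "retail L h t' t''"
  shows "retail L h t t''"
  unfolding retail_def
proof
  fix e
  consider "t' e = t e" | "t'' e = t' e"
    | X Y where "X \<in> L" "Y \<in> L" "t e \<in> X" "t' e \<in> X" "h e \<notin> X" "t' e \<in> Y" "t'' e \<in> Y" "h e \<notin> Y"
    using assms(2,3) unfolding retail_def by metis
  then show "t'' e = t e \<or> (\<exists>X\<in>L. t e \<in> X \<and> t'' e \<in> X \<and> h e \<notin> X)"
  proof cases
    case 3
    then have "X \<subseteq> Y \<or> Y \<subseteq> X" using assms(1) unfolding laminar_def by blast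
    then show ?thesis using 3 by blast
  qed (use assms(2,3) in \<open>unfold retail_def, metis+\<close>)
qed

lemma tight_arb_retail:
  assumes T: "tight_arb L h t F B r" and L: "finite L" "laminar L" "F \<in> L" and t': "retail L h t t'"
  shows "tight_arb L h t' F B r"
proof -
  \<comment> \<open>\<open>u S\<close> performs the changes witnessed by members of
    \<open>S\<close>. Inserting \<open>X\<close> into \<open>S\<close> affects only arcs leaving
    \<open>X\<close>, so \<open>tight_arb_change_tails_leaving\<close> applies to one member at a
    time.\<close>
  define u where "u S e = (if \<exists>X\<in>S. t e \<in> X \<and> t' e \<in> X \<and> h e \<notin> X then t' e else t e)" for S e
  have "S \<subseteq> L \<Longrightarrow> tight_arb L h (u S) F B r" if "finite S" for S
    using that
  proof (induction S)
    case empty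
    then show ?case using T by (simp add: u_def)
  next
    case (insert X S)
    then have "tight_arb L h (u S) F B r" "X \<in> L" by auto
    then show ?case by (rule tight_arb_change_tails_leaving[OF _ L(2,3)]) (auto simp: u_def)
  qed
  moreover have "u L e = t' e" for e
  proof (cases "t' e = t e")
    case False
    then have "\<exists>X\<in>L. t e \<in> X \<and> t' e \<in> X \<and> h e \<notin> X" using t' unfolding retail_def by blast
    then show ?thesis unfolding u_def by (rule if_P)
  qed (simp add: u_def)
  then have "u L = t'" by blast
  ultimately show ?thesis using L(1) by force
qed

section \<open>Roots of tight arborescences\<close>

definition roots :: "'a set set \<Rightarrow> ('b \<Rightarrow> 'a) \<Rightarrow> 'b set \<Rightarrow> ('b \<Rightarrow> 'a) \<Rightarrow> 'a set \<Rightarrow> 'a set" where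
  "roots L h E t F = {r. \<exists>B\<subseteq>E. tight_arb L h t F B r}"

definition closed_in :: "('b \<Rightarrow> 'a) \<Rightarrow> 'b set \<Rightarrow> ('b \<Rightarrow> 'a) \<Rightarrow> 'a set \<Rightarrow> 'a set \<Rightarrow> bool" where
  "closed_in h E t F Z \<longleftrightarrow> Z \<noteq> {} \<and> Z \<subseteq> F \<and> (\<forall>e\<in>E. t e \<in> F \<longrightarrow> h e \<in> Z \<longrightarrow> t e \<in> Z)"

text \<open>For \<open>E = arcs G - H\<close> this means that \<open>H\<close> contains all arcs of
  \<open>G \<restriction> F\<close> entering two disjoint non-empty sets, so that
  \<open>\<mu> (G \<restriction> F)\<close> is at most \<open>card H\<close>.\<close>

definition disjoint_closed :: "('b \<Rightarrow> 'a) \<Rightarrow> 'b set \<Rightarrow> ('b \<Rightarrow> 'a) \<Rightarrow> 'a set \<Rightarrow> bool" where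
  "disjoint_closed h E t F \<longleftrightarrow> (\<exists>Z1 Z2. closed_in h E t F Z1 \<and> closed_in h E t F Z2 \<and> Z1 \<inter> Z2 = {})"

text \<open>A tight arborescence can enter \<open>X\<close> only at a root of \<open>X\<close>. If the arcs leaving \<open>X\<close> start at roots
  as well, the other nodes of \<open>X\<close> do not matter outside \<open>X\<close>, and \<open>X\<close> need not be contracted.\<close>

definition rooted_tails :: "'a set set \<Rightarrow> ('b \<Rightarrow> 'a) \<Rightarrow> 'b set \<Rightarrow> ('b \<Rightarrow> 'a) \<Rightarrow> 'a set \<Rightarrow> bool" where
  "rooted_tails L h E t F \<longleftrightarrow> (\<forall>X\<in>L. X \<subset> F \<longrightarrow>
     (\<forall>e\<in>E. t e \<in> X \<longrightarrow> h e \<in> F - X \<longrightarrow> t e \<in> roots L h E t X))"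

lemma rootsI: "B \<subseteq> E \<Longrightarrow> tight_arb L h t F B r \<Longrightarrow> r \<in> roots L h E t F"
  unfolding roots_def by blast

lemma rootsE:
  assumes "r \<in> roots L h E t F"
  obtains B where "B \<subseteq> E" "tight_arb L h t F B r"
  using assms unfolding roots_def by blast

lemma roots_insert_singletons: "roots (L \<union> (\<lambda>v. {v}) ` V) h E t F = roots L h E t F"
  unfolding roots_def tight_arb_insert_singletons ..

lemma roots_singleton: "roots L h E t {v} = {v}"
  using tight_arb_singleton[of L h t v] tight_arbD(1)[of L h t "{v}"] unfolding roots_def by auto

lemma roots_subset: "roots L h E t F \<subseteq> F"
  unfolding roots_def using tight_arbD(1) by fastforce

lemma roots_restrict:
  assumes "X \<in> L" "X \<subseteq> F" "r \<in> roots L h E t F" "r \<in> X"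
  shows "r \<in> roots L h E t X"
proof -
  obtain B where B: "B \<subseteq> E" "tight_arb L h t F B r" using assms(3) by (rule rootsE)
  have "tight_arb L h t X {e \<in> B. t e \<in> X \<and> h e \<in> X} r"
    by (rule tight_arb_restrict[OF B(2) assms(1,2)]) (use assms(4) in auto)
  moreover have "{e \<in> B. t e \<in> X \<and> h e \<in> X} \<subseteq> E" using B(1) by blast
  ultimately show ?thesis by (rule rootsI[rotated])
qed

lemma roots_retail:
  assumes "finite L" "laminar L" "F \<in> L" "retail L h t t'"
  shows "roots L h E t' F = roots L h E t F"
  using tight_arb_retail[OF _ assms] tight_arb_retail[OF _ assms(1-3) retail_sym[OF assms(4)]]
  unfolding roots_def by blast

section \<open>Roots and closed sets\<close>

lemma roots_subset_closed:
  assumes "closed_in h E t F Z"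
  shows "roots L h E t F \<subseteq> Z"
proof
  fix r assume "r \<in> roots L h E t F"
  then obtain B where B: "B \<subseteq> E" "tight_arb L h t F B r" by (rule rootsE)
  show "r \<in> Z"
  proof (rule ccontr)
    assume "r \<notin> Z"
    then obtain e where "e \<in> B" "t e \<notin> Z" "h e \<in> Z"
      using tight_arbD(6)[OF B(2), of Z] assms unfolding closed_in_def by blast
    then show False using assms B(1) tight_arbD(2)[OF B(2)] unfolding closed_in_def by blast
  qed
qed

lemma roots_imp_not_disjoint_closed:
  assumes "roots L h E t F \<noteq> {}"
  shows "\<not> disjoint_closed h E t F"
  using roots_subset_closed[of h E t F _ L] assms unfolding disjoint_closed_def by blast

lemma closed_in_Int:
  assumes "closed_in h E t F Z" "X \<subseteq> F" "Z \<inter> X \<noteq> {}"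
  shows "closed_in h E t X (Z \<inter> X)"
  using assms unfolding closed_in_def by blast

lemma rooted_tails_mono:
  assumes "rooted_tails L h E t F" "X \<subseteq> F"
  shows "rooted_tails L h E t X"
  using assms unfolding rooted_tails_def by blast

text \<open>If \<open>Z\<close> meets \<open>X\<close>, it contains all roots of \<open>X\<close>,
  so something remains. An arc from a removed node to a remaining one cannot leave \<open>X\<close>,
  as its tail is not a root; inside \<open>X\<close> it would end in a root, although the roots of
  \<open>X\<close> are closed.\<close>

lemma closed_in_trim:
  assumes rt: "rooted_tails L h E t F" and X: "X \<in> L" "X \<subset> F" "closed_in h E t X (roots L h E t X)"
    and Z: "closed_in h E t F Z"
  shows "closed_in h E t F (Z - (X - roots L h E t X))" (is "closed_in h E t F ?Z")
proof -
  have "?Z \<noteq> {}"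
  proof (cases "Z \<inter> X = {}")
    case True
    then show ?thesis using Z unfolding closed_in_def by blast
  next
    case False
    then have "roots L h E t X \<subseteq> Z \<inter> X"
      using roots_subset_closed closed_in_Int[OF Z] X(2) by (metis psubset_imp_subset)
    then show ?thesis using X(3) unfolding closed_in_def by blast
  qed
  moreover have "t e \<in> ?Z" if "e \<in> E" "t e \<in> F" "h e \<in> ?Z" for e
  proof (rule ccontr)
    assume "t e \<notin> ?Z"
    moreover have "t e \<in> Z" using Z that unfolding closed_in_def by blast
    ultimately have "t e \<in> X" "t e \<notin> roots L h E t X" by auto
    then have "h e \<in> X" using rt X(1,2) that Z unfolding rooted_tails_def closed_in_def by blast
    then show False using X(3) that \<open>t e \<in> X\<close> \<open>t e \<notin> roots L h E t X\<close> unfolding closed_in_def by blast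
  qed
  ultimately show ?thesis using Z unfolding closed_in_def by blast
qed

section \<open>Assembling arborescences from maximal members\<close>

lemma maximal_block:
  assumes "finite F" "laminar L" "X0 \<in> L" "X0 \<subset> F" "v \<in> X0"
  obtains K where "K \<in> L" "K \<subset> F" "v \<in> K" "\<And>X. X \<in> L \<Longrightarrow> X \<subset> F \<Longrightarrow> X \<inter> K \<noteq> {} \<Longrightarrow> X \<subseteq> K"
proof -
  let ?S = "{X \<in> L. X \<subset> F \<and> v \<in> X}"
  have fin: "finite ?S" by (rule finite_subset[of _ "Pow F"]) (use assms(1) in auto)
  have "X0 \<in> ?S" using assms(3-5) by simp
  from finite_has_maximal2[OF fin this]
  obtain K where K: "K \<in> ?S" and max: "\<forall>X\<in>?S. K \<subseteq> X \<longrightarrow> K = X"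
    by (elim bexE conjE)
  have "X \<subseteq> K" if X: "X \<in> L" "X \<subset> F" "X \<inter> K \<noteq> {}" for X
  proof -
    have "X \<subseteq> K \<or> K \<subseteq> X" using assms(2) X K unfolding laminar_def by blast
    then show ?thesis
    proof
      assume "K \<subseteq> X"
      then have "X \<in> ?S" using X K by blast
      then show ?thesis using max \<open>K \<subseteq> X\<close> by blast
    qed
  qed
  then show ?thesis using that K by blast
qed

text \<open>A member inside \<open>K\<close> that contains \<open>h e\<close> is entered by
  \<open>e\<close> alone, as \<open>B'\<close> enters no member containing its root; any other
  member inside \<open>K\<close> can be entered by arcs of \<open>B'\<close> only.\<close>

lemma tight_arb_attach:
  assumes T: "tight_arb L h t W B r" and T': "tight_arb L h t K B' (h e)"
    and e: "t e \<in> W" and WK: "W \<inter> K = {}"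
    and L: "\<And>X. X \<in> L \<Longrightarrow> X \<subseteq> W \<union> K \<Longrightarrow> X \<subseteq> W \<or> X \<subseteq> K \<or> X = W \<union> K"
  shows "tight_arb L h t (W \<union> K) (insert e (B \<union> B')) r"
proof (rule tight_arbI)
  have he: "h e \<in> K" using tight_arbD(1)[OF T'] .
  note W = tight_arbD(2-4)[OF T] and K = tight_arbD(2-4)[OF T']
  have arcs: "f = e \<and> t f \<in> W \<and> h f \<in> K \<or> f \<in> B \<and> t f \<in> W \<and> h f \<in> W \<or> f \<in> B' \<and> t f \<in> K \<and> h f \<in> K"
    if "f \<in> insert e (B \<union> B')" for f
    using that W[of f] K[of f] e he by auto
  show "r \<in> W \<union> K" using tight_arbD(1)[OF T] by blast
  show "t f \<in> W \<union> K \<and> h f \<in> W \<union> K \<and> h f \<noteq> r" if "f \<in> insert e (B \<union> B')" for f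
  proof -
    have "h f \<noteq> r" using arcs[OF that] W(3) tight_arbD(1)[OF T] WK by blast
    then show ?thesis using arcs[OF that] by blast
  qed
  show "inj_on h (insert e (B \<union> B'))"
  proof (rule inj_onI)
    fix f g assume f: "f \<in> insert e (B \<union> B')" and g: "g \<in> insert e (B \<union> B')" and "h f = h g"
    then show "f = g"
      using arcs[OF f] arcs[OF g] WK K(3)[of f] K(3)[of g] tight_arbD(5)[OF T] tight_arbD(5)[OF T']
      by (auto dest: inj_onD)
  qed
  show "\<exists>f\<in>insert e (B \<union> B'). t f \<notin> Z \<and> h f \<in> Z" if Z: "Z \<noteq> {}" "Z \<subseteq> W \<union> K - {r}" for Z
  proof (cases "Z \<inter> W = {}")
    case False
    then obtain f where "f \<in> B" "t f \<notin> Z \<inter> W" "h f \<in> Z \<inter> W"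
      using tight_arbD(6)[OF T, of "Z \<inter> W"] Z by blast
    then show ?thesis using W(1)[of f] by blast
  next
    case True
    show ?thesis
    proof (cases "h e \<in> Z")
      case True
      then show ?thesis using e \<open>Z \<inter> W = {}\<close> by blast
    next
      case False
      then show ?thesis using tight_arbD(6)[OF T', of Z] Z \<open>Z \<inter> W = {}\<close> by blast
    qed
  qed
  fix X f assume X: "X \<in> L" "X \<subseteq> W \<union> K" and f: "f \<in> insert e (B \<union> B')" "t f \<notin> X" "h f \<in> X"
  have "X \<noteq> W \<union> K" using arcs[OF f(1)] f by blast
  then consider "X \<subseteq> W" | "X \<subseteq> K" using L[OF X] by blast
  then have "r \<notin> X \<and> (\<forall>g \<in> insert e (B \<union> B'). t g \<notin> X \<longrightarrow> h g \<in> X \<longrightarrow> g = f)"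
  proof cases
    case 1
    have inB: "g \<in> B" if "g \<in> insert e (B \<union> B')" "h g \<in> X" for g
      using arcs[OF that(1)] that(2) 1 WK by blast
    show ?thesis
      using tight_arbD(7)[OF T X(1) 1, of f] tight_arbD(8)[OF T X(1) 1, of f] inB f by blast
  next
    case 2
    have inB: "g = e \<or> g \<in> B'" if "g \<in> insert e (B \<union> B')" "h g \<in> X" for g
      using arcs[OF that(1)] that(2) 2 WK by blast
    have "g = f" if g: "g \<in> insert e (B \<union> B')" "t g \<notin> X" "h g \<in> X" for g
    proof (cases "h e \<in> X")
      case True
      then have "g \<notin> B'" "f \<notin> B'" using tight_arbD(7)[OF T' X(1) 2] f g by blast+
      then show ?thesis using inB f g by blast
    next
      case False
      then have "g \<in> B'" "f \<in> B'" using inB f g by blast+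
      then show ?thesis using tight_arbD(8)[OF T' X(1) 2] f g by blast
    qed
    moreover have "r \<notin> X" using tight_arbD(1)[OF T] 2 WK by blast
    ultimately show ?thesis by blast
  qed
  then show "r \<notin> X" and "\<And>g. g \<in> insert e (B \<union> B') \<Longrightarrow> t g \<notin> X \<Longrightarrow> h g \<in> X \<Longrightarrow> g = f"
    by blast+
qed

text \<open>An arborescence is grown from \<open>r\<close> by whole maximal members; a dead end
  would yield a closed set avoiding \<open>r\<close>.\<close>

lemma root_if_reaching:
  assumes F: "finite F" "laminar L" and sing: "\<And>v. v \<in> F \<Longrightarrow> {v} \<in> L"
    and ne: "\<And>X. X \<in> L \<Longrightarrow> X \<subset> F \<Longrightarrow> roots L h E t X \<noteq> {}"
    and rt: "rooted_tails L h E t F"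
    and cl: "\<And>X. X \<in> L \<Longrightarrow> X \<subset> F \<Longrightarrow> closed_in h E t X (roots L h E t X)"
    and r: "r \<in> F" "\<And>X. X \<in> L \<Longrightarrow> X \<subset> F \<Longrightarrow> r \<in> X \<Longrightarrow> r \<in> roots L h E t X"
    and reach: "\<And>Z. closed_in h E t F Z \<Longrightarrow> r \<in> Z"
  shows "r \<in> roots L h E t F"
proof (cases "F = {r}")
  case True
  then show ?thesis by (simp add: roots_singleton)
next
  case False
  have block: "\<exists>K. K \<in> L \<and> K \<subset> F \<and> v \<in> K \<and> (\<forall>X\<in>L. X \<subset> F \<longrightarrow> X \<inter> K \<noteq> {} \<longrightarrow> X \<subseteq> K)"
    if "v \<in> F" for v
  proof -
    have "{v} \<subset> F" using that False r(1) by blast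
    then show ?thesis using maximal_block[OF F sing[OF that], of v] by (metis insertI1)
  qed
  \<comment> \<open>With all singletons in the family, the maximal members strictly inside
    \<open>F\<close> partition \<open>F\<close>; a good \<open>W\<close> is a union of such
    blocks.\<close>
  define good where "good W \<longleftrightarrow> W \<subseteq> F \<and> r \<in> W \<and> (\<forall>X\<in>L. X \<subset> F \<longrightarrow> X \<subseteq> W \<or> X \<inter> W = {}) \<and>
    (\<exists>B\<subseteq>E. tight_arb L h t W B r)" for W
  obtain K0 where K0: "K0 \<in> L" "K0 \<subset> F" "r \<in> K0" "\<forall>X\<in>L. X \<subset> F \<longrightarrow> X \<inter> K0 \<noteq> {} \<longrightarrow> X \<subseteq> K0"
    using block[OF r(1)] by blast
  have "r \<in> roots L h E t K0" using r(2) K0 by blast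
  then obtain B0 where "B0 \<subseteq> E" "tight_arb L h t K0 B0 r" by (rule rootsE)
  moreover have "X \<subseteq> K0 \<or> X \<inter> K0 = {}" if "X \<in> L" "X \<subset> F" for X using K0(4) that by blast
  ultimately have K0_good: "K0 \<in> Collect good"
    using K0(2,3) unfolding good_def mem_Collect_eq by (intro conjI) auto
  have "finite (Collect good)"
    by (rule finite_subset[of _ "Pow F"]) (use F in \<open>auto simp: good_def\<close>)
  from finite_has_maximal2[OF this K0_good]
  obtain W where "W \<in> Collect good" and max: "\<forall>W'\<in>Collect good. W \<subseteq> W' \<longrightarrow> W = W'"
    by (elim bexE conjE)
  then have "good W" by simp
  then have W: "W \<subseteq> F" "r \<in> W" "\<And>X. X \<in> L \<Longrightarrow> X \<subset> F \<Longrightarrow> X \<subseteq> W \<or> X \<inter> W = {}"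
    and ex: "\<exists>B\<subseteq>E. tight_arb L h t W B r" unfolding good_def by simp_all
  from ex obtain B where B: "B \<subseteq> E" "tight_arb L h t W B r" by blast
  have "W = F"
  proof (rule ccontr)
    assume "W \<noteq> F"
    \<comment> \<open>The nodes outside \<open>W\<close> from which their block can be spanned. A
      root of a block outside \<open>W\<close> qualifies, since smaller members inherit roots, so
      \<open>Z\<close> is non-empty and, avoiding \<open>r\<close>, not closed.\<close>
    define Z where "Z = {v \<in> F - W. \<forall>X\<in>L. X \<subset> F \<longrightarrow> v \<in> X \<longrightarrow> v \<in> roots L h E t X}"
    obtain v where v: "v \<in> F" "v \<notin> W" using \<open>W \<noteq> F\<close> W(1) by blast
    obtain K where K: "K \<in> L" "K \<subset> F" "v \<in> K" "\<forall>X\<in>L. X \<subset> F \<longrightarrow> X \<inter> K \<noteq> {} \<longrightarrow> X \<subseteq> K"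
      using block[OF v(1)] by blast
    obtain u where u: "u \<in> roots L h E t K" using ne[OF K(1,2)] by blast
    have uK: "u \<in> K" using u roots_subset by fast
    have "u \<in> roots L h E t X" if "X \<in> L" "X \<subset> F" "u \<in> X" for X
      using roots_restrict[OF that(1) _ u that(3)] K(4) that uK by blast
    moreover have "u \<in> F - W" using W(3)[OF K(1,2)] K v uK by blast
    ultimately have "Z \<noteq> {}" unfolding Z_def by blast
    then have "\<not> closed_in h E t F Z" "Z \<subseteq> F" using reach[of Z] W(2) unfolding Z_def by blast+
    then obtain e where e: "e \<in> E" "t e \<in> F" "h e \<in> Z" "t e \<notin> Z"
      using \<open>Z \<noteq> {}\<close> unfolding closed_in_def by blast
    \<comment> \<open>A tail outside \<open>W\<close> and \<open>Z\<close> would be a non-root of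
      some \<open>X\<close>. If the arc leaves \<open>X\<close>, this contradicts
      \<open>rooted_tails\<close>; if not, it ends in a root of \<open>X\<close>, and the roots of
      \<open>X\<close> are closed.\<close>
    have teW: "t e \<in> W"
    proof (rule ccontr)
      assume "t e \<notin> W"
      then obtain X where X: "X \<in> L" "X \<subset> F" "t e \<in> X" "t e \<notin> roots L h E t X"
        using e(2,4) unfolding Z_def by blast
      have "h e \<in> F" "h e \<in> X \<Longrightarrow> h e \<in> roots L h E t X" using e(3) X(1,2) unfolding Z_def by blast+
      then show False
        using rt cl[OF X(1,2)] X e(1) unfolding rooted_tails_def closed_in_def by blast
    qed
    have he: "h e \<in> F" "h e \<notin> W" using e(3) unfolding Z_def by blast+
    obtain K' where K': "K' \<in> L" "K' \<subset> F" "h e \<in> K'" "\<forall>X\<in>L. X \<subset> F \<longrightarrow> X \<inter> K' \<noteq> {} \<longrightarrow> X \<subseteq> K'"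
      using block[OF he(1)] by blast
    have "h e \<in> roots L h E t K'" using e(3) K' unfolding Z_def by blast
    then obtain B' where B': "B' \<subseteq> E" "tight_arb L h t K' B' (h e)" by (rule rootsE)
    have WK: "W \<inter> K' = {}" using W(3)[OF K'(1,2)] K'(3) he(2) by blast
    have sub: "X \<subseteq> W \<or> X \<subseteq> K' \<or> X \<inter> (W \<union> K') = {}" if "X \<in> L" "X \<subset> F" for X
      using W(3)[OF that] K'(4) that by blast
    have "tight_arb L h t (W \<union> K') (insert e (B \<union> B')) r"
    proof (rule tight_arb_attach[OF B(2) B'(2) teW WK])
      fix X assume X: "X \<in> L" "X \<subseteq> W \<union> K'"
      have "W \<union> K' \<subseteq> F" using W(1) K'(2) by blast
      then show "X \<subseteq> W \<or> X \<subseteq> K' \<or> X = W \<union> K'"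
        using sub[OF X(1)] X(2) by blast
    qed
    moreover have "insert e (B \<union> B') \<subseteq> E" using B B' e(1) by blast
    moreover have "W \<union> K' \<subseteq> F" using W(1) K'(2) by blast
    moreover have "\<forall>X\<in>L. X \<subset> F \<longrightarrow> X \<subseteq> W \<union> K' \<or> X \<inter> (W \<union> K') = {}" using sub by blast
    ultimately have "good (W \<union> K')" using W(2) unfolding good_def by blast
    then show False using max K'(3) he(2) by blast
  qed
  then show ?thesis using B by (blast intro: rootsI)
qed

text \<open>The roots form the least closed set \<open>M\<close>: any two closed sets meet and their
  intersection is closed, so a minimal one lies in all others.\<close>

lemma closed_in_roots_singletons:
  assumes "finite F" "F \<noteq> {}" "laminar L" and sing: "\<And>v. v \<in> F \<Longrightarrow> {v} \<in> L"
    and ne: "\<And>X. X \<in> L \<Longrightarrow> X \<subset> F \<Longrightarrow> roots L h E t X \<noteq> {}"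
    and "rooted_tails L h E t F" and "\<not> disjoint_closed h E t F"
  shows "closed_in h E t F (roots L h E t F)"
  using assms
proof (induction F rule: finite_psubset_induct)
  case (psubset F)
  have cl: "closed_in h E t X (roots L h E t X)" if X: "X \<in> L" "X \<subset> F" for X
  proof (rule psubset.IH[OF X(2)])
    show "X \<noteq> {}" using psubset.prems(4)[OF X] roots_subset by fast
    show "rooted_tails L h E t X" using psubset.prems(5) X(2) by (blast intro: rooted_tails_mono)
    show "\<not> disjoint_closed h E t X"
      by (rule roots_imp_not_disjoint_closed[OF psubset.prems(4)[OF X]])
  qed (use psubset.prems X in auto)
  let ?C = "Collect (closed_in h E t F)"
  have F: "F \<in> ?C" using psubset.prems(1) unfolding closed_in_def by simp
  have "finite ?C"
    by (rule finite_subset[of _ "Pow F"]) (use psubset.hyps in \<open>auto simp: closed_in_def\<close>)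
  from finite_has_minimal2[OF this F]
  obtain M where "M \<in> ?C" and M_le: "\<forall>Z\<in>?C. Z \<subseteq> M \<longrightarrow> M = Z"
    by (elim bexE conjE)
  then have M: "closed_in h E t F M" by simp
  have min: "Z = M" if "closed_in h E t F Z" "Z \<subseteq> M" for Z using M_le that by blast
  have "M \<subseteq> roots L h E t F"
  proof
    fix r assume "r \<in> M"
    show "r \<in> roots L h E t F"
    proof (rule root_if_reaching[OF psubset.hyps psubset.prems(2-5) cl])
      show "r \<in> F" using \<open>r \<in> M\<close> M unfolding closed_in_def by blast
      show "r \<in> roots L h E t X" if "X \<in> L" "X \<subset> F" "r \<in> X" for X
      proof -
        \<comment> \<open>Trimming cannot shrink the minimal set \<open>M\<close>, so every node of
          \<open>M\<close> in \<open>X\<close> is a root of \<open>X\<close>.\<close>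
        have "M - (X - roots L h E t X) = M"
          by (rule min[OF closed_in_trim[OF psubset.prems(5) that(1,2) cl[OF that(1,2)] M]]) blast
        then show ?thesis using \<open>r \<in> M\<close> that(3) by blast
      qed
      show "r \<in> Z" if Z: "closed_in h E t F Z" for Z
      proof -
        have "Z \<inter> M \<noteq> {}" using Z M psubset.prems(6) unfolding disjoint_closed_def by blast
        then have "closed_in h E t F (Z \<inter> M)" using Z M unfolding closed_in_def by blast
        then show ?thesis using min[of "Z \<inter> M"] \<open>r \<in> M\<close> by blast
      qed
    qed
  qed
  then have "roots L h E t F = M" using roots_subset_closed[OF M, of L] by blast
  then show ?case using M by simp
qed

text \<open>Singletons are added for the block decomposition. They change no set of roots and
  respect \<open>rooted_tails\<close>, because their only node is a root.\<close>

lemma closed_in_roots: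
  assumes "finite F" "F \<noteq> {}" "laminar L"
    and ne: "\<And>X. X \<in> L \<Longrightarrow> X \<subset> F \<Longrightarrow> roots L h E t X \<noteq> {}"
    and rt: "rooted_tails L h E t F" and "\<not> disjoint_closed h E t F"
  shows "closed_in h E t F (roots L h E t F)"
proof -
  let ?L = "L \<union> (\<lambda>v. {v}) ` F"
  have roots: "roots ?L h E t X = roots L h E t X" for X by (rule roots_insert_singletons)
  have "laminar ?L" using assms(3) unfolding laminar_def by auto
  moreover have "roots ?L h E t X \<noteq> {}" if "X \<in> ?L" "X \<subset> F" for X
    using that ne by (auto simp: roots roots_singleton)
  moreover have "rooted_tails ?L h E t F"
    using rt unfolding rooted_tails_def roots by (auto simp: roots_singleton)
  ultimately have "closed_in h E t F (roots ?L h E t F)"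
    using assms by (intro closed_in_roots_singletons) auto
  then show ?thesis by (simp add: roots)
qed

section \<open>Tails at anchor nodes\<close>

text \<open>\<open>t\<close> stands for the tails of \<open>D'\<close>, \<open>E\<close> for the
  arcs left after a deletion, and \<open>a X\<close> for the anchor chosen at \<open>X\<close>. An
  arc leaving several members ends up at the anchor of the last one treated, which contains the
  others; hence \<open>Y\<close> in the last assumption.\<close>

locale anchored_tails =
  fixes L :: "'a set set" and h :: "'b \<Rightarrow> 'a" and E :: "'b set" and t :: "'b \<Rightarrow> 'a" and a :: "'a set \<Rightarrow> 'a"
  assumes fin: "finite (\<Union>L)" and lam: "laminar L"
    and anchor_in: "\<And>X. X \<in> L \<Longrightarrow> a X \<in> X"
    and tails: "\<And>X e. X \<in> L \<Longrightarrow> e \<in> E \<Longrightarrow> t e \<in> X \<Longrightarrow> h e \<notin> X \<Longrightarrow>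
      \<exists>Y\<in>L. X \<subseteq> Y \<and> h e \<notin> Y \<and> t e = a Y"
begin

lemma finite_family: "finite L"
  using fin by (rule finite_UnionD)

lemma finite_member: "X \<in> L \<Longrightarrow> finite X"
  by (rule finite_subset[OF Union_upper fin])

lemma member_nonempty: "X \<in> L \<Longrightarrow> X \<noteq> {}"
  using anchor_in by blast

abbreviation R :: "'a set \<Rightarrow> 'a set" where
  "R \<equiv> roots L h E t"

definition bad :: "'a set \<Rightarrow> bool" where
  "bad X \<longleftrightarrow> X \<in> L \<and> a X \<notin> R X"

definition bad_rooted :: "'a \<Rightarrow> 'a set \<Rightarrow> bool" where
  "bad_rooted v F \<longleftrightarrow> (\<forall>W. bad W \<longrightarrow> W \<subset> F \<longrightarrow> v \<in> R W)"

section \<open>Tails of leaving arcs and bad members\<close>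

lemma tail_cases:
  assumes F: "F \<in> L" and Y: "Y \<in> L" and e: "e \<in> E" "t e \<in> Y" "h e \<in> F - Y" "Y \<subset> F"
  obtains W where "W \<in> L" "Y \<subseteq> W" "W \<subset> F" "h e \<notin> W" "t e = a W"
proof -
  obtain W where W: "W \<in> L" "Y \<subseteq> W" "h e \<notin> W" "t e = a W"
    using tails[OF Y] e by blast
  have "W \<subseteq> F \<or> F \<subseteq> W \<or> W \<inter> F = {}" using lam F W(1) unfolding laminar_def by blast
  then have "W \<subset> F" using e W by blast
  then show ?thesis using that W by blast
qed

lemma bad_superset:
  assumes "bad W" "W \<subseteq> Y" "Y \<in> L" "a Y = a W"
  shows "bad Y"
  using assms roots_restrict[of W L Y "a W" h E t] anchor_in unfolding bad_def by auto

text \<open>The tail is the anchor of some \<open>W\<close> containing \<open>Y\<close>. As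
  \<open>W\<close> is not bad, the tail is a root of \<open>W\<close>, and \<open>Y\<close> inherits
  it.\<close>

lemma rooted_tails_if_no_bad:
  assumes F: "F \<in> L" and nb: "\<And>W. bad W \<Longrightarrow> \<not> W \<subset> F"
  shows "rooted_tails L h E t F"
  unfolding rooted_tails_def
proof (intro ballI impI)
  fix Y e assume Y: "Y \<in> L" "Y \<subset> F" and e: "e \<in> E" "t e \<in> Y" "h e \<in> F - Y"
  obtain W where W: "W \<in> L" "Y \<subseteq> W" "W \<subset> F" "h e \<notin> W" "t e = a W"
    by (rule tail_cases[OF F Y(1) e Y(2)])
  then have "t e \<in> R W" using nb unfolding bad_def by auto
  then show "t e \<in> R Y" using roots_restrict[OF Y(1) W(2) _ e(2)] by blast
qed

text \<open>In contrast to the tails of \<open>D\<^sub>v\<close>, only the tails violating \<^const>\<open>rooted_tails\<close> are moved to \<open>v\<close>: the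
  arcs leaving a member of which \<open>v\<close> is not a root must stay.\<close>

definition repair :: "'a \<Rightarrow> 'a set \<Rightarrow> 'b \<Rightarrow> 'a" where
  "repair v F e = (if \<exists>Y\<in>L. Y \<subset> F \<and> e \<in> E \<and> t e \<in> Y \<and> h e \<in> F - Y \<and> t e \<notin> R Y then v else t e)"

text \<open>A violating tail \<open>a W\<close> is not a root of the smaller \<open>Y\<close>, hence
  not of \<open>W\<close>; so \<open>W\<close> is bad and \<open>v\<close> is one of its
  roots.\<close>

lemma repair_cases:
  assumes F: "F \<in> L" and v: "bad_rooted v F"
  obtains "repair v F e = t e"
    and "\<And>Y. Y \<in> L \<Longrightarrow> Y \<subset> F \<Longrightarrow> e \<in> E \<Longrightarrow> t e \<in> Y \<Longrightarrow> h e \<in> F - Y \<Longrightarrow> t e \<in> R Y"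
  | W where "repair v F e = v" "bad W" "W \<subset> F" "e \<in> E" "h e \<in> F - W" "t e = a W" "v \<in> R W"
proof (cases "\<exists>Y\<in>L. Y \<subset> F \<and> e \<in> E \<and> t e \<in> Y \<and> h e \<in> F - Y \<and> t e \<notin> R Y")
  case True
  then obtain Y where Y: "Y \<in> L" "Y \<subset> F" and e: "e \<in> E" "t e \<in> Y" "h e \<in> F - Y" and nr: "t e \<notin> R Y"
    by blast
  obtain W where W: "W \<in> L" "Y \<subseteq> W" "W \<subset> F" "h e \<notin> W" "t e = a W"
    by (rule tail_cases[OF F Y(1) e Y(2)])
  have "t e \<notin> R W" using roots_restrict[OF Y(1) W(2) _ e(2)] nr by blast
  then have "bad W" using W unfolding bad_def by simp
  moreover have "repair v F e = v" unfolding repair_def using True by (rule if_P)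
  ultimately show ?thesis using that(2) W e v unfolding bad_rooted_def by blast
next
  case False
  then have "repair v F e = t e" unfolding repair_def by (rule if_not_P)
  then show ?thesis using that(1) False by blast
qed

context
  fixes v F
  assumes F: "F \<in> L" and v: "bad_rooted v F"
begin

lemma retail_repair: "retail L h t (repair v F)"
  unfolding retail_def
proof
  fix e
  show "repair v F e = t e \<or> (\<exists>X\<in>L. t e \<in> X \<and> repair v F e \<in> X \<and> h e \<notin> X)"
  proof (cases rule: repair_cases[OF F v, of e])
    case (2 W)
    then have "W \<in> L" unfolding bad_def by blast
    moreover have "v \<in> W" using 2(7) roots_subset by fast
    moreover have "t e \<in> W" using anchor_in[OF \<open>W \<in> L\<close>] 2(6) by simp
    ultimately show ?thesis using 2(1,5) by auto
  qed simp_all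
qed

lemma roots_repair: "X \<in> L \<Longrightarrow> roots L h E (repair v F) X = R X"
  by (rule roots_retail[OF finite_family lam _ retail_repair])

lemma rooted_tails_repair: "rooted_tails L h E (repair v F) F"
  unfolding rooted_tails_def
proof (intro ballI impI)
  fix Y e assume Y: "Y \<in> L" "Y \<subset> F" and e: "e \<in> E" "repair v F e \<in> Y" "h e \<in> F - Y"
  have "repair v F e \<in> R Y"
  proof (cases rule: repair_cases[OF F v, of e])
    case 1
    then show ?thesis using Y e by simp
  next
    case (2 W)
    have W: "W \<in> L" using 2(2) unfolding bad_def by blast
    have vY: "v \<in> Y" using e(2) 2(1) by simp
    have "Y \<subseteq> W \<or> W \<subseteq> Y" using lam W Y(1) vY 2(7) roots_subset unfolding laminar_def by fast
    then have "\<exists>U. Y \<subseteq> U \<and> v \<in> R U"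
    proof
      \<comment> \<open>The original tail \<open>a W\<close> now lies in \<open>Y\<close>, so it is
        also the anchor of some \<open>U\<close> containing \<open>Y\<close>. Sharing its anchor
        with the smaller \<open>W\<close>, \<open>U\<close> is bad as well and has \<open>v\<close>
        as a root.\<close>
      assume "W \<subseteq> Y"
      then have "t e \<in> Y" using anchor_in[OF W] 2(6) by auto
      then obtain U where U: "U \<in> L" "Y \<subseteq> U" "U \<subset> F" "h e \<notin> U" "t e = a U"
        by (rule tail_cases[OF F Y(1) e(1) _ e(3) Y(2)])
      have "bad U" using bad_superset[OF 2(2) _ U(1)] \<open>W \<subseteq> Y\<close> U(2,5) 2(6) by simp
      then show ?thesis using v U(2,3) unfolding bad_rooted_def by blast
    qed (use 2(7) in blast)
    then show ?thesis using roots_restrict[OF Y(1)] vY 2(1) by auto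
  qed
  then show "repair v F e \<in> roots L h E (repair v F) Y" by (simp add: roots_repair[OF Y(1)])
qed

text \<open>No arc moved to \<open>v\<close> can end in \<open>Z\<close>, for otherwise
  \<open>v\<close> would belong to \<open>Z\<close>.\<close>

lemma closed_in_unrepair:
  assumes Z: "closed_in h E (repair v F) F Z" and "v \<notin> Z"
  shows "closed_in h E t F Z"
proof -
  have "t e \<in> Z" if e: "e \<in> E" "t e \<in> F" "h e \<in> Z" for e
  proof (cases rule: repair_cases[OF F v, of e])
    case 1
    then show ?thesis using Z e unfolding closed_in_def by auto
  next
    case (2 W)
    then have "v \<in> F" using roots_subset by fast
    then have "v \<in> Z" using Z e 2(1) unfolding closed_in_def by auto
    then show ?thesis using \<open>v \<notin> Z\<close> by blast
  qed
  then show ?thesis using Z unfolding closed_in_def by blast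
qed

end

section \<open>A root in every member\<close>

lemma closed_in_roots_retail:
  assumes "F \<in> L" "retail L h t c" "rooted_tails L h E c F" "\<not> disjoint_closed h E c F"
    and ne: "\<forall>X\<in>L. X \<subset> F \<longrightarrow> R X \<noteq> {}"
  shows "closed_in h E c F (R F)"
proof -
  have "roots L h E c X = R X" if "X \<in> L" for X
    by (rule roots_retail[OF finite_family lam that assms(2)])
  then show ?thesis
    using closed_in_roots[OF finite_member member_nonempty lam _ assms(3,4)] assms(1) ne by metis
qed

text \<open>With \<open>E = arcs D - H\<close>, the first three assumptions follow from
  \<open>card H < best\<close>: two from the values of \<open>\<mu>\<close> on \<open>D'\<close> and
  on \<open>D\<^sub>v\<close>, the third because two disjoint closed sets missing their anchors
  would each account for more than half of \<open>H\<close>.\<close>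

lemma roots_nonempty:
  assumes no_disj: "\<And>F. F \<in> L \<Longrightarrow> \<not> disjoint_closed h E t F"
    and no_disj_at: "\<And>F v. F \<in> L \<Longrightarrow> v \<in> F \<Longrightarrow> \<not> disjoint_closed h E
       (\<lambda>e. if \<exists>X\<in>L. v \<in> X \<and> t e \<in> X \<and> h e \<notin> X then v else t e) F"
    and anchors: "\<And>X Y Z1 Z2. X \<in> L \<Longrightarrow> Y \<in> L \<Longrightarrow> closed_in h E t X Z1 \<Longrightarrow> closed_in h E t Y Z2 \<Longrightarrow>
       Z1 \<inter> Z2 = {} \<Longrightarrow> a X \<in> Z1 \<or> a Y \<in> Z2"
    and "X \<in> L"
  shows "R X \<noteq> {}"
proof (rule ccontr)
  assume "\<not> R X \<noteq> {}"
  then have X: "X \<in> {F \<in> L. R F = {}}" using \<open>X \<in> L\<close> by simp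
  have "finite {F \<in> L. R F = {}}" using finite_family by simp
  from finite_has_minimal2[OF this X]
  obtain F where "F \<in> {F \<in> L. R F = {}}" and F_le: "\<forall>G\<in>{F \<in> L. R F = {}}. G \<subseteq> F \<longrightarrow> F = G"
    by (elim bexE conjE)
  then have F: "F \<in> L" and empty: "R F = {}" by simp_all
  have ne: "\<forall>X\<in>L. X \<subset> F \<longrightarrow> R X \<noteq> {}" using F_le by blast
  have refl: "retail L h t t" unfolding retail_def by blast
  have F_disj: "disjoint_closed h E c F" if "retail L h t c" "rooted_tails L h E c F" for c
  proof (rule ccontr)
    assume "\<not> disjoint_closed h E c F"
    from closed_in_roots_retail[OF F that this ne] show False
      using empty unfolding closed_in_def by blast
  qed
  \<comment> \<open>Strictly inside the minimal counterexample \<open>F\<close> roots exist, which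
    already rules out disjoint closed sets.\<close>
  have sub_closed: "closed_in h E c G (R G)"
    if "G \<in> L" "G \<subset> F" "retail L h t c" "rooted_tails L h E c G" for G c
  proof (rule closed_in_roots_retail[OF that(1,3,4)])
    have "roots L h E c G \<noteq> {}"
      using ne that(1,2) roots_retail[OF finite_family lam that(1,3), of E] by simp
    then show "\<not> disjoint_closed h E c G" by (rule roots_imp_not_disjoint_closed)
  qed (use ne that in blast)
  let ?B = "{W. bad W \<and> W \<subset> F}"
  have finB: "finite ?B" using finite_family by (rule rev_finite_subset) (auto simp: bad_def)
  have "\<exists>W. W \<in> ?B"
    using F_disj[OF refl] rooted_tails_if_no_bad[OF F] no_disj[OF F] by blast
  then obtain W0 where "W0 \<in> ?B" by blast
  from finite_has_minimal2[OF finB this]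
  obtain F1 where "F1 \<in> ?B" and F1_le: "\<forall>W\<in>?B. W \<subseteq> F1 \<longrightarrow> F1 = W"
    by (elim bexE conjE)
  then have F1: "bad F1" "F1 \<subset> F" "F1 \<in> L" "a F1 \<notin> R F1" unfolding bad_def by simp_all
  \<comment> \<open>No bad set lies strictly inside \<open>F1\<close>, so here the original tails
    serve.\<close>
  have "rooted_tails L h E t F1"
    using rooted_tails_if_no_bad[OF F1(3)] F1_le F1(2) by blast
  then have R_F1: "closed_in h E t F1 (R F1)" by (rule sub_closed[OF F1(3,2) refl])
  obtain v where v: "v \<in> R F1" using ne F1(2,3) by blast
  have vF1: "v \<in> F1" using v roots_subset by fast
  have bad_root: "v \<in> R W" if "W \<in> ?B" for W
  proof (rule ccontr)
    assume "v \<notin> R W"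
    then have G0: "W \<in> {W \<in> ?B. v \<notin> R W}" using that by simp
    have "finite {W \<in> ?B. v \<notin> R W}" using finB by (rule rev_finite_subset) blast
    from finite_has_minimal2[OF this G0]
    obtain G where "G \<in> {W \<in> ?B. v \<notin> R W}" and G_le: "\<forall>W\<in>{W \<in> ?B. v \<notin> R W}. W \<subseteq> G \<longrightarrow> G = W"
      by (elim bexE conjE)
    then have G: "bad G" "G \<subset> F" "G \<in> L" "a G \<notin> R G" "v \<notin> R G" unfolding bad_def by simp_all
    \<comment> \<open>By minimality of \<open>G\<close>, the bad sets strictly inside
      \<open>G\<close> have the root \<open>v\<close>, so tails can be repaired in \<open>G\<close>.
      The closed set \<open>R G\<close> misses \<open>v\<close> and is therefore closed for the
      original tails too.\<close>
    have vG: "bad_rooted v G" using G_le G(2) unfolding bad_rooted_def by blast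
    have "closed_in h E (repair v G) G (R G)"
      by (rule sub_closed[OF G(3,2) retail_repair[OF G(3) vG] rooted_tails_repair[OF G(3) vG]])
    note R_G = this closed_in_unrepair[OF G(3) vG this G(5)]
    \<comment> \<open>A common node makes \<open>F1\<close> a subset of \<open>G\<close>; then
      \<open>R G\<close> meets \<open>F1\<close> in a closed set, which must contain the root
      \<open>v\<close> of \<open>F1\<close>.\<close>
    have "R F1 \<inter> R G = {}"
    proof (rule ccontr)
      assume ne': "R F1 \<inter> R G \<noteq> {}"
      then have "G \<inter> F1 \<noteq> {}" using roots_subset[of L h E t F1] roots_subset[of L h E t G] by blast
      then have "G \<subseteq> F1 \<or> F1 \<subseteq> G" using lam F1(3) G(3) unfolding laminar_def by blast
      moreover have "F1 = G" if "G \<subseteq> F1" using F1_le G(1,2) that by blast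
      ultimately have "F1 \<subseteq> G" by blast
      then have "closed_in h E (repair v G) F1 (R G \<inter> F1)"
        using closed_in_Int[OF R_G(1)] ne' roots_subset[of L h E t F1] by blast
      then have "roots L h E (repair v G) F1 \<subseteq> R G" using roots_subset_closed by fast
      then show False using roots_repair[OF G(3) vG F1(3)] v G(5) by blast
    qed
    then show False using anchors[OF F1(3) G(3) R_F1 R_G(2)] F1(4) G(4) by blast
  qed
  show False
  proof (cases "\<forall>Y\<in>L. F1 \<subseteq> Y \<longrightarrow> Y \<subset> F \<longrightarrow> v \<in> R Y")
    case True
    define c where "c e = (if \<exists>X\<in>L. v \<in> X \<and> t e \<in> X \<and> h e \<notin> X then v else t e)" for e
    have v_root: "v \<in> R Y" if "Y \<in> L" "Y \<subset> F" "v \<in> Y" for Y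
    proof -
      have "Y \<subseteq> F1 \<or> F1 \<subseteq> Y" using lam F1(3) that vF1 unfolding laminar_def by blast
      then show ?thesis using roots_restrict[OF that(1) _ v that(3)] True that by blast
    qed
    have c: "retail L h t c" unfolding retail_def c_def by auto
    have "rooted_tails L h E c F"
      unfolding rooted_tails_def
    proof (intro ballI impI)
      fix Y e assume Y: "Y \<in> L" "Y \<subset> F" and e: "e \<in> E" "c e \<in> Y" "h e \<in> F - Y"
      have "c e \<in> R Y"
      proof (cases "\<exists>X\<in>L. v \<in> X \<and> t e \<in> X \<and> h e \<notin> X")
        case True
        then have "c e = v" unfolding c_def by (rule if_P)
        then show ?thesis using v_root Y e(2) by simp
      next
        case False
        then have ce: "c e = t e" unfolding c_def by (rule if_not_P)
        obtain W where W: "W \<in> L" "Y \<subseteq> W" "W \<subset> F" "h e \<notin> W" "t e = a W"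
          by (rule tail_cases[OF F Y(1) e(1) e(2)[unfolded ce] e(3) Y(2)])
        \<comment> \<open>With \<open>v\<close> in \<open>W\<close> the arc would have been moved to
          \<open>v\<close>. As all bad sets inside \<open>F\<close> contain \<open>v\<close>, this
          \<open>W\<close> is not bad.\<close>
        have "v \<notin> W" using False W e(2) ce by auto
        then have "\<not> bad W" using bad_root[of W] W(3) roots_subset by fast
        then have "t e \<in> R W" using W unfolding bad_def by simp
        then show ?thesis using roots_restrict[OF Y(1) W(2)] ce e(2) by simp
      qed
      then show "c e \<in> roots L h E c Y" using roots_retail[OF finite_family lam Y(1) c, of E] by simp
    qed
    from F_disj[OF c this] show False
      using no_disj_at[OF F, of v] vF1 F1(2) unfolding c_def by blast
  next
    case False
    then obtain F2 where F2: "F2 \<in> L" "F1 \<subseteq> F2" "F2 \<subset> F" "v \<notin> R F2" by blast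
    have vF: "bad_rooted v F" using bad_root unfolding bad_rooted_def by blast
    let ?c = "repair v F"
    note c = retail_repair[OF F vF] rooted_tails_repair[OF F vF]
    have c2: "rooted_tails L h E ?c F2" using rooted_tails_mono[OF c(2)] F2(3) by blast
    have roots2: "roots L h E ?c F2 = R F2" by (rule roots_repair[OF F vF F2(1)])
    have R_F2: "closed_in h E ?c F2 (roots L h E ?c F2)"
      unfolding roots2 by (rule sub_closed[OF F2(1,3) c(1) c2])
    \<comment> \<open>Removing the non-roots of \<open>F2\<close> removes \<open>v\<close>, after
      which the set is closed for the original tails as well.\<close>
    have trim: "closed_in h E t F (Z - (F2 - R F2))" if Z: "closed_in h E ?c F Z" for Z
    proof (rule closed_in_unrepair[OF F vF])
      show "closed_in h E ?c F (Z - (F2 - R F2))"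
        using closed_in_trim[OF c(2) F2(1,3) R_F2 Z] unfolding roots2 .
      show "v \<notin> Z - (F2 - R F2)" using vF1 F2(2,4) by blast
    qed
    obtain Z1 Z2 where "closed_in h E ?c F Z1" "closed_in h E ?c F Z2" "Z1 \<inter> Z2 = {}"
      using F_disj[OF c] unfolding disjoint_closed_def by blast
    then have "disjoint_closed h E t F"
      unfolding disjoint_closed_def using trim[of Z1] trim[of Z2] by blast
    then show False using no_disj[OF F] by blast
  qed
qed

end

section \<open>Arborescences of digraphs\<close>

lemma bidirect_simps [simp]:
  "verts (bidirect G) = verts G"
  "arcs (bidirect G) = arcs G \<times> UNIV"
  "tail (bidirect G) (e, fwd) = (if fwd then tail G e else head G e)"
  "head (bidirect G) (e, fwd) = (if fwd then head G e else tail G e)"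
  by (simp_all add: bidirect_def)

section \<open>Walks in the bidirected multigraph\<close>

lemma (in pre_digraph) cas_tails:
  "cas u p v \<Longrightarrow> tail G ` set p \<subseteq> insert u (head G ` set p)"
  by (induction p arbitrary: u) auto

lemma (in pre_digraph) cas_end:
  "cas u p v \<Longrightarrow> p \<noteq> [] \<Longrightarrow> v \<in> head G ` set p"
proof (induction p arbitrary: u)
  case (Cons e p)
  then show ?case by (cases "p = []") auto
qed simp

lemma cas_bidirect:
  "pre_digraph.cas G u p v \<Longrightarrow> pre_digraph.cas (bidirect G) u (map (\<lambda>e. (e, True)) p) v"
  by (induction p arbitrary: u) (auto simp: pre_digraph.cas.simps)

lemma awalk_verts_bidirect:
  "pre_digraph.awalk_verts (bidirect G) u (map (\<lambda>e. (e, True)) p) = pre_digraph.awalk_verts G u p"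
  by (induction p arbitrary: u) (auto simp: pre_digraph.awalk_verts.simps)

text \<open>Traversed forwards, a directed cycle is a cycle of the underlying multigraph that
  repeats no arc.\<close>

lemma (in wf_digraph) undirected_tree_imp_acyclic:
  assumes "undirected_tree G"
  shows "acyclic (arcs_ends G)"
proof (rule acyclicI, rule allI, rule notI)
  fix u assume "(u, u) \<in> (arcs_ends G)\<^sup>+"
  then obtain p where "awalk u p u" "p \<noteq> []" using reachable1_awalk by blast
  then have "\<exists>p. closed_w p" unfolding closed_w_def by blast
  then obtain p where "cycle p" using closed_w_imp_cycle by blast
  then obtain v where v: "awalk v p v" "distinct (tl (awalk_verts v p))" "distinct p" "p \<noteq> []"
    unfolding cycle_conv by blast
  let ?p = "map (\<lambda>e. (e, True)) p"
  have "pre_digraph.awalk (bidirect G) v ?p v"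
    unfolding pre_digraph.awalk_def
    using v(1) cas_bidirect[of G v p v] by (auto simp: awalk_def)
  then have "pre_digraph.cycle (bidirect G) ?p"
    unfolding pre_digraph.cycle_def using v(2,4) awalk_verts_bidirect[of G v p]
    by (intro exI[of _ v]) simp
  moreover have "distinct (map fst ?p)" using v(3) by (simp add: comp_def)
  ultimately show False using assms unfolding undirected_tree_def by blast
qed

lemma (in wf_digraph) connected_no_crossing:
  assumes "connected G" and R: "R \<noteq> {}" "R \<subseteq> verts G"
    and "\<And>e. e \<in> arcs G \<Longrightarrow> tail G e \<in> R \<longleftrightarrow> head G e \<in> R"
  shows "R = verts G"
proof -
  obtain r where r: "r \<in> R" using R(1) by blast
  have "v \<in> R" if "v \<in> verts G" for v
  proof -
    have "r \<rightarrow>\<^sup>*\<^bsub>with_proj (mk_symmetric G)\<^esub> v"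
      using assms(1) r R(2) that unfolding connected_def strongly_connected_def by auto
    then have "(r, v) \<in> (parcs (mk_symmetric G))\<^sup>*"
      unfolding reachable_def by (auto dest: rtrancl_on_rtranclI)
    then show ?thesis
      by (induction rule: rtrancl_induct) (use r assms(4) in \<open>auto simp: parcs_mk_symmetric\<close>)
  qed
  then show ?thesis using R(2) by blast
qed

section \<open>Arborescences in cut form\<close>

context fin_digraph
begin

lemma fin_digraph_arcs_subset: "B \<subseteq> arcs G \<Longrightarrow> fin_digraph (G\<lparr>arcs := B\<rparr>)"
  by unfold_locales (auto intro: finite_subset)

lemma in_degree_le_1_iff:
  assumes "B \<subseteq> arcs G"
  shows "(\<forall>v\<in>verts G. in_degree (G\<lparr>arcs := B\<rparr>) v \<le> 1) \<longleftrightarrow> inj_on (head G) B"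
proof -
  have "finite B" using assms finite_arcs by (rule finite_subset)
  then have "in_degree (G\<lparr>arcs := B\<rparr>) v \<le> 1 \<longleftrightarrow>
      (\<forall>e\<in>B. \<forall>f\<in>B. head G e = v \<longrightarrow> head G f = v \<longrightarrow> e = f)" for v
    unfolding in_degree_def in_arcs_def by (auto simp: card_le_Suc0_iff_eq)
  then have "(\<forall>v\<in>verts G. in_degree (G\<lparr>arcs := B\<rparr>) v \<le> 1) \<longleftrightarrow>
      (\<forall>v\<in>verts G. \<forall>e\<in>B. \<forall>f\<in>B. head G e = v \<longrightarrow> head G f = v \<longrightarrow> e = f)" by simp
  also have "\<dots> \<longleftrightarrow> inj_on (head G) B"
    unfolding inj_on_def using assms head_in_verts by fastforce
  finally show ?thesis .
qed

lemma in_degree_eq_0_iff: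
  assumes "B \<subseteq> arcs G"
  shows "in_degree (G\<lparr>arcs := B\<rparr>) v = 0 \<longleftrightarrow> (\<forall>e\<in>B. head G e \<noteq> v)"
proof -
  have "finite B" using assms finite_arcs by (rule finite_subset)
  then show ?thesis unfolding in_degree_def in_arcs_def by auto
qed

text \<open>Acyclicity provides a source \<open>r\<close>. No arc of \<open>B\<close> crosses the
  boundary of the set reachable from \<open>r\<close>, so by connectedness this set contains all
  nodes.\<close>

lemma arborescence_imp_tight_arb:
  assumes "arborescence G B"
  shows "\<exists>r. tight_arb {} (head G) (tail G) (verts G) B r"
proof -
  let ?B = "G\<lparr>arcs := B\<rparr>"
  have B: "B \<subseteq> arcs G" and tree: "undirected_tree ?B" and inj: "inj_on (head G) B"
    using assms in_degree_le_1_iff[of B] unfolding arborescence_def by auto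
  interpret B: fin_digraph ?B using B by (rule fin_digraph_arcs_subset)
  have ends: "arcs_ends ?B = (\<lambda>e. (tail G e, head G e)) ` B" by (simp add: arcs_ends_conv)
  have "finite (arcs_ends ?B)" unfolding ends using B finite_arcs by (meson finite_imageI finite_subset)
  then have wf: "wf (arcs_ends ?B)"
    using B.undirected_tree_imp_acyclic[OF tree] by (rule finite_acyclic_wf)
  have conn: "connected ?B" using tree unfolding undirected_tree_def by blast
  then obtain v where "v \<in> verts G" unfolding connected_def strongly_connected_def by auto
  have source: "\<exists>r\<in>Z. \<forall>e\<in>B. head G e \<noteq> r"
    if Z: "Z \<noteq> {}" "\<And>e. e \<in> B \<Longrightarrow> head G e \<in> Z \<Longrightarrow> tail G e \<in> Z" for Z
  proof -
    obtain r where r: "r \<in> Z" "\<And>y. (y, r) \<in> arcs_ends ?B \<Longrightarrow> y \<notin> Z"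
      using wfE_min'[OF wf Z(1)] by blast
    have "head G e \<noteq> r" if "e \<in> B" for e
    proof
      assume "head G e = r"
      then have "(tail G e, r) \<in> arcs_ends ?B" unfolding ends using that by blast
      then show False using r Z(2)[OF that] \<open>head G e = r\<close> by blast
    qed
    then show ?thesis using r(1) by blast
  qed
  obtain r where r: "r \<in> verts G" "\<And>e. e \<in> B \<Longrightarrow> head G e \<noteq> r"
    using source[of "verts G"] \<open>v \<in> verts G\<close> B tail_in_verts by blast
  define R where "R = {v. (r, v) \<in> (arcs_ends ?B)\<^sup>*}"
  have step: "head G e \<in> R" if "e \<in> B" "tail G e \<in> R" for e
  proof -
    have "(tail G e, head G e) \<in> arcs_ends ?B" unfolding ends using that(1) by blast
    then show ?thesis using that(2) unfolding R_def by auto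
  qed
  \<comment> \<open>Heads are injective, so the last arc of a path from \<open>r\<close> to
    \<open>head G e\<close> is \<open>e\<close> itself.\<close>
  have pred: "tail G e \<in> R" if e: "e \<in> B" "head G e \<in> R" for e
  proof -
    have "(r, head G e) \<in> (arcs_ends ?B)\<^sup>*" using e(2) unfolding R_def by simp
    then show ?thesis
    proof (cases rule: rtranclE)
      case base
      then show ?thesis using r(2)[OF e(1)] by simp
    next
      case (step u)
      then obtain f where f: "f \<in> B" "tail G f = u" "head G f = head G e" unfolding ends by auto
      then have "f = e" using inj e(1) by (auto dest: inj_onD)
      then show ?thesis using f step unfolding R_def by simp
    qed
  qed
  have "v \<in> verts G" if "(r, v) \<in> (arcs_ends ?B)\<^sup>*" for v
    using that by (induction rule: rtrancl_induct) (use r(1) B in \<open>auto simp: ends\<close>)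
  then have sub: "R \<subseteq> verts G" unfolding R_def by blast
  have "r \<in> R" unfolding R_def by simp
  have "R = verts ?B"
  proof (rule B.connected_no_crossing[OF conn])
    show "tail ?B e \<in> R \<longleftrightarrow> head ?B e \<in> R" if "e \<in> arcs ?B" for e
      using step[of e] pred[of e] that by auto
  qed (use sub \<open>r \<in> R\<close> in auto)
  then have R: "R = verts G" by simp
  have "tight_arb {} (head G) (tail G) (verts G) B r"
  proof (rule tight_arbI)
    fix Z assume Z: "Z \<noteq> {}" "Z \<subseteq> verts G - {r}"
    show "\<exists>e\<in>B. tail G e \<notin> Z \<and> head G e \<in> Z"
    proof (rule ccontr)
      assume no: "\<not> (\<exists>e\<in>B. tail G e \<notin> Z \<and> head G e \<in> Z)"
      obtain z where "z \<in> Z" using Z(1) by blast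
      then have "(r, z) \<in> (arcs_ends ?B)\<^sup>*" using Z(2) R unfolding R_def by blast
      then have "r \<in> Z"
        by (induction rule: converse_rtrancl_induct) (use \<open>z \<in> Z\<close> no in \<open>auto simp: ends\<close>)
      then show False using Z(2) by blast
    qed
  qed (use r inj B in auto)
  then show ?thesis by blast
qed

text \<open>A cycle has as many nodes as arcs, and its arcs have distinct heads among its nodes
  \<open>C\<close>. So each node of \<open>C\<close> is the head of a cycle arc, no other arc of
  \<open>B\<close> ends in \<open>C\<close>, and \<open>C\<close> avoids \<open>r\<close> without
  being entered.\<close>

lemma tight_arb_imp_no_undirected_cycle:
  assumes T: "tight_arb {} (head G) (tail G) (verts G) B r" and B: "B \<subseteq> arcs G"
  shows "\<not> (\<exists>p. pre_digraph.cycle (bidirect (G\<lparr>arcs := B\<rparr>)) p \<and> distinct (map fst p))"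
proof
  let ?B = "bidirect (G\<lparr>arcs := B\<rparr>)"
  assume "\<exists>p. pre_digraph.cycle ?B p \<and> distinct (map fst p)"
  then obtain p u where p: "pre_digraph.awalk ?B u p u" "distinct (tl (pre_digraph.awalk_verts ?B u p))"
    "p \<noteq> []" and dist: "distinct (map fst p)" unfolding pre_digraph.cycle_def by blast
  have cas: "pre_digraph.cas ?B u p u" and pB: "set p \<subseteq> B \<times> UNIV"
    using p(1) unfolding pre_digraph.awalk_def by (auto simp: bidirect_def)
  define C where "C = head ?B ` set p"
  have "pre_digraph.awalk_verts ?B u p = tail ?B (hd p) # map (head ?B) p"
    using pre_digraph.awalk_verts_conv'[OF cas] p(3) by simp
  then have "distinct (map (head ?B) p)" using p(2) by simp
  then have "card C = card (fst ` set p)"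
    unfolding C_def using distinct_card[OF dist] distinct_card[of "map (head ?B) p"] by simp
  moreover have inj: "inj_on (head G) (fst ` set p)"
    by (rule inj_on_subset[OF tight_arbD(5)[OF T]]) (use pB in auto)
  ultimately have card: "card (head G ` fst ` set p) = card C" by (simp add: card_image)
  have "u \<in> C" using pre_digraph.cas_end[OF cas p(3)] unfolding C_def .
  then have "tail ?B ` set p \<subseteq> C" using pre_digraph.cas_tails[OF cas] unfolding C_def by blast
  then have ends: "head G e \<in> C \<and> tail G e \<in> C" if "(e, b) \<in> set p" for e b
    using that unfolding C_def by (cases b) (force simp: image_subset_iff)+
  then have "head G ` fst ` set p \<subseteq> C" by force
  then have C: "head G ` fst ` set p = C"
    using card by (intro card_subset_eq) (auto simp: C_def)
  have "C \<subseteq> verts G - {r}"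
    unfolding C[symmetric] using tight_arbD(3,4)[OF T] pB by fastforce
  then obtain e where e: "e \<in> B" "tail G e \<notin> C" "head G e \<in> C"
    using tight_arbD(6)[OF T, of C] \<open>u \<in> C\<close> by blast
  then obtain f where f: "f \<in> fst ` set p" "head G f = head G e" using C by (metis imageE)
  then have "f = e" using tight_arbD(5)[OF T] e(1) pB by (auto dest: inj_onD)
  then show False using f(1) e(2) ends by auto
qed

lemma tight_arb_imp_arborescence:
  assumes T: "tight_arb {} (head G) (tail G) (verts G) B r" and B: "B \<subseteq> arcs G"
  shows "arborescence G B"
proof -
  let ?B = "G\<lparr>arcs := B\<rparr>"
  interpret B: fin_digraph ?B using B by (rule fin_digraph_arcs_subset)
  interpret M: pair_wf_digraph "mk_symmetric ?B" by (rule B.wellformed_mk_symmetric)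
  let ?S = "(parcs (mk_symmetric ?B))"
  have step: "(tail G e, head G e) \<in> ?S" if "e \<in> B" for e
    using that by (auto simp: parcs_mk_symmetric)
  have sym: "(y, x) \<in> ?S" if "(x, y) \<in> ?S" for x y
    using that by (auto simp: parcs_mk_symmetric)
  define R where "R = {v \<in> verts G. (r, v) \<in> rtrancl_on (verts G) ?S}"
  have "verts G - R = {}"
  proof (rule ccontr)
    assume "verts G - R \<noteq> {}"
    moreover have "r \<in> R" using tight_arbD(1)[OF T] unfolding R_def by simp
    ultimately obtain e where e: "e \<in> B" "tail G e \<notin> verts G - R" "head G e \<in> verts G - R"
      using tight_arbD(6)[OF T, of "verts G - R"] by blast
    then have "tail G e \<in> R" using tight_arbD(2)[OF T] by blast
    then have "head G e \<in> R"
      using step[OF e(1)] e(3) unfolding R_def by (auto intro: rtrancl_on_into_rtrancl_on)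
    then show False using e(3) by blast
  qed
  then have reach: "(r, v) \<in> rtrancl_on (verts G) ?S" if "v \<in> verts G" for v
    using that unfolding R_def by blast
  have "(u, v) \<in> rtrancl_on (verts G) ?S" if "u \<in> verts G" "v \<in> verts G" for u v
    using reach[OF that(1)] reach[OF that(2)] rtrancl_on_sym[OF symI[of ?S, OF sym], of "verts G"]
    by (meson rtrancl_on_trans symD)
  then have "connected ?B"
    using tight_arbD(1)[OF T] unfolding connected_def strongly_connected_def reachable_def
    by auto
  then show ?thesis
    using tight_arb_imp_no_undirected_cycle[OF T B] B in_degree_le_1_iff[OF B] tight_arbD(5)[OF T]
    unfolding arborescence_def undirected_tree_def by blast
qed

lemma arborescence_tight_iff:
  assumes B: "B \<subseteq> arcs G" and L: "L \<subseteq> Pow (verts G)"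
  shows "arborescence G B \<and> tight G L B \<longleftrightarrow> (\<exists>r. tight_arb L (head G) (tail G) (verts G) B r)"
proof -
  have "finite B" using B finite_arcs by (rule finite_subset)
  then have le1: "\<rho> (G\<lparr>arcs := B\<rparr>) X \<le> 1 \<longleftrightarrow> (\<forall>e\<in>B. \<forall>f\<in>B. tail G e \<notin> X \<longrightarrow> head G e \<in> X \<longrightarrow>
      tail G f \<notin> X \<longrightarrow> head G f \<in> X \<longrightarrow> f = e)" for X
    unfolding \<rho>_def entering_def by (auto simp: card_le_Suc0_iff_eq)
  have eq0: "\<rho> (G\<lparr>arcs := B\<rparr>) X = 0 \<longleftrightarrow> (\<forall>e\<in>B. tail G e \<notin> X \<longrightarrow> head G e \<notin> X)" for X
    unfolding \<rho>_def entering_def using \<open>finite B\<close> by auto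
  have tight: "tight G L B \<longleftrightarrow> tight_arb L (head G) (tail G) (verts G) B r"
    if T: "tight_arb {} (head G) (tail G) (verts G) B r" for r
  proof -
    have root: "is_root G B x \<longleftrightarrow> x = r" for x
    proof
      assume x: "is_root G B x"
      then have "x \<in> verts G" "\<forall>e\<in>B. head G e \<noteq> x"
        unfolding is_root_def using in_degree_eq_0_iff[OF B] by auto
      then show "x = r" using tight_arbD(6)[OF T, of "{x}"] by blast
    next
      assume "x = r"
      then show "is_root G B x"
        unfolding is_root_def using in_degree_eq_0_iff[OF B] tight_arbD(1,4)[OF T] by auto
    qed
    have "tight G L B \<longleftrightarrow> (\<forall>X\<in>L. (\<forall>e\<in>B. tail G e \<notin> X \<longrightarrow> head G e \<in> X \<longrightarrow>
        r \<notin> X \<and> (\<forall>f\<in>B. tail G f \<notin> X \<longrightarrow> head G f \<in> X \<longrightarrow> f = e)))"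
      unfolding tight_def root le1 eq0 by blast
    also have "\<dots> \<longleftrightarrow> tight_arb L (head G) (tail G) (verts G) B r"
    proof
      assume "\<forall>X\<in>L. (\<forall>e\<in>B. tail G e \<notin> X \<longrightarrow> head G e \<in> X \<longrightarrow>
        r \<notin> X \<and> (\<forall>f\<in>B. tail G f \<notin> X \<longrightarrow> head G f \<in> X \<longrightarrow> f = e))"
      then show "tight_arb L (head G) (tail G) (verts G) B r"
        using T unfolding tight_arb_def by simp
    next
      assume "tight_arb L (head G) (tail G) (verts G) B r"
      moreover have "X \<subseteq> verts G" if "X \<in> L" for X using L that by blast
      ultimately show "\<forall>X\<in>L. (\<forall>e\<in>B. tail G e \<notin> X \<longrightarrow> head G e \<in> X \<longrightarrow>
        r \<notin> X \<and> (\<forall>f\<in>B. tail G f \<notin> X \<longrightarrow> head G f \<in> X \<longrightarrow> f = e))"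
        unfolding tight_arb_def by simp
    qed
    finally show ?thesis .
  qed
  have "tight_arb {} (head G) (tail G) (verts G) B r" if "tight_arb L (head G) (tail G) (verts G) B r" for r
    using that unfolding tight_arb_def by simp
  then show ?thesis
    using tight arborescence_imp_tight_arb[of B] tight_arb_imp_arborescence[OF _ B] by blast
qed

lemma \<gamma>_eq:
  assumes "L \<subseteq> Pow (verts G)"
  shows "\<gamma> G L = (INF H \<in> {H. H \<subseteq> arcs G \<and> roots L (head G) (arcs G - H) (tail G) (verts G) = {}}.
    enat (card H))"
proof -
  have "(\<exists>B. arborescence (G\<lparr>arcs := arcs G - H\<rparr>) B \<and> tight (G\<lparr>arcs := arcs G - H\<rparr>) L B) \<longleftrightarrow>
      roots L (head G) (arcs G - H) (tail G) (verts G) \<noteq> {}" for H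
  proof -
    interpret H: fin_digraph "G\<lparr>arcs := arcs G - H\<rparr>" by (rule fin_digraph_arcs_subset) blast
    have "arborescence (G\<lparr>arcs := arcs G - H\<rparr>) B \<and> tight (G\<lparr>arcs := arcs G - H\<rparr>) L B \<longleftrightarrow>
      B \<subseteq> arcs G - H \<and> (\<exists>r. tight_arb L (head G) (tail G) (verts G) B r)" for B
      using H.arborescence_tight_iff[of B L] assms unfolding arborescence_def by auto
    then show ?thesis unfolding roots_def by auto
  qed
  then show ?thesis unfolding \<gamma>_def by simp
qed

end

section \<open>The procedure\<close>

text \<open>The counted arcs lie in \<open>H\<close>, and none is counted twice, as
  \<open>Z1\<close> and \<open>Z2\<close> share no head. Distinct \<open>X\<close> and
  \<open>Y\<close> are needed for pairs of anchors at different members.\<close>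

lemma sum_\<rho>_le_if_closed:
  assumes "finite H" and Z1: "closed_in (head G) (arcs G - H) (tail G) X Z1"
    and Z2: "closed_in (head G) (arcs G - H) (tail G) Y Z2" and disj: "Z1 \<inter> Z2 = {}"
  shows "\<rho> (G \<restriction> X) Z1 + \<rho> (G \<restriction> Y) Z2 \<le> card H"
proof -
  have sub: "entering (G \<restriction> X) Z1 \<subseteq> H" "entering (G \<restriction> Y) Z2 \<subseteq> H"
    using Z1 Z2 unfolding entering_def closed_in_def by auto
  have "\<rho> (G \<restriction> X) Z1 + \<rho> (G \<restriction> Y) Z2 = card (entering (G \<restriction> X) Z1 \<union> entering (G \<restriction> Y) Z2)"
    unfolding \<rho>_def using disj sub assms(1)
    by (subst card_Un_disjoint) (auto intro: finite_subset simp: entering_def)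
  also have "\<dots> \<le> card H" using sub assms(1) by (intro card_mono) auto
  finally show ?thesis .
qed

lemma \<mu>_le_if_disjoint_closed:
  assumes "finite H" "disjoint_closed (head G) (arcs G - H) (tail G) F"
  shows "\<mu> (G \<restriction> F) \<le> enat (card H)"
proof -
  obtain Z1 Z2 where Z1: "closed_in (head G) (arcs G - H) (tail G) F Z1"
    and Z2: "closed_in (head G) (arcs G - H) (tail G) F Z2" and disj: "Z1 \<inter> Z2 = {}"
    using assms(2) unfolding disjoint_closed_def by blast
  have "enat (\<rho> (G \<restriction> F) Z1 + \<rho> (G \<restriction> F) Z2) \<le> enat (card H)"
    using sum_\<rho>_le_if_closed[OF assms(1) Z1 Z2 disj] by simp
  moreover have "Z1 \<noteq> {} \<and> Z1 \<subset> F \<and> Z2 \<noteq> {} \<and> Z2 \<subset> F \<and> Z1 \<inter> Z2 = {}"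
    using Z1 Z2 disj unfolding closed_in_def by blast
  then have "\<mu> (G \<restriction> F) \<le> enat (\<rho> (G \<restriction> F) Z1 + \<rho> (G \<restriction> F) Z2)"
    unfolding \<mu>_def by (intro INF_lower2[of "(Z1, Z2)"]) auto
  ultimately show ?thesis by (rule order_trans[rotated])
qed

section \<open>The invariant of Phase 1\<close>

lemma \<rho>_redirect_restrict:
  assumes "X \<inter> F = {} \<and> a \<notin> X \<or> X \<subseteq> F"
  shows "\<rho> (redirect G F a \<restriction> X) Z = \<rho> (G \<restriction> X) Z"
proof -
  have "entering (redirect G F a \<restriction> X) Z = entering (G \<restriction> X) Z"
    using assms by (auto simp: entering_def redirect_def split: if_splits)
  then show ?thesis unfolding \<rho>_def by simp
qed

text \<open>Moved arcs end outside \<open>F\<close>, hence outside any \<open>X\<close> contained in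
  \<open>F\<close>; if \<open>X\<close> is disjoint from \<open>F\<close>, they start outside
  \<open>X\<close> before and after. Thus no cut of the induced digraph changes.\<close>

lemma anchor_redirect_restrict:
  assumes "X \<inter> F = {} \<and> a \<notin> X \<or> X \<subseteq> F"
  shows "anchor (redirect G F a \<restriction> X) = anchor (G \<restriction> X)"
  unfolding anchor_def \<mu>_def \<rho>_redirect_restrict[OF assms] by (simp add: redirect_def)

text \<open>\<open>S\<close> consists of the members treated so far. All arc names are considered,
  because \<open>redirect\<close> changes the tail function on all of them.\<close>

definition anchored :: "('a, 'b) pre_digraph \<Rightarrow> 'a set set \<Rightarrow> ('a set \<Rightarrow> 'a) \<Rightarrow> bool" where
  "anchored G S a \<longleftrightarrow> (\<forall>X\<in>S. anchor (G \<restriction> X) (a X)) \<and>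
     (\<forall>X\<in>S. \<forall>e. tail G e \<in> X \<longrightarrow> head G e \<notin> X \<longrightarrow>
        (\<exists>Y\<in>S. X \<subseteq> Y \<and> head G e \<notin> Y \<and> tail G e = a Y))"

lemma anchored_redirect:
  assumes G: "anchored G S a" and F: "F \<notin> S" "anchor (G \<restriction> F) x"
    and cross: "\<And>X. X \<in> S \<Longrightarrow> X \<subseteq> F \<or> X \<inter> F = {}"
  shows "anchored (redirect G F x) (insert F S) (a(F := x))"
proof -
  let ?G = "redirect G F x"
  have xF: "x \<in> F" using F(2) unfolding anchor_def by simp
  have "anchor (?G \<restriction> X) ((a(F := x)) X)" if "X \<in> insert F S" for X
  proof (cases "X = F")
    case True
    then show ?thesis using F(2) by (simp add: anchor_redirect_restrict)
  next
    case False
    then have X: "X \<in> S" using that by blast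
    then have "X \<inter> F = {} \<and> x \<notin> X \<or> X \<subseteq> F" using cross[OF X] xF by blast
    then show ?thesis using G X False unfolding anchored_def by (simp add: anchor_redirect_restrict)
  qed
  moreover have "\<exists>Y\<in>insert F S. X \<subseteq> Y \<and> head ?G e \<notin> Y \<and> tail ?G e = (a(F := x)) Y"
    if X: "X \<in> insert F S" and e: "tail ?G e \<in> X" "head ?G e \<notin> X" for X e
  proof (cases "tail G e \<in> F \<and> head G e \<notin> F")
    case True
    then have "tail ?G e = x" "head ?G e \<notin> F" unfolding redirect_def by auto
    \<comment> \<open>For an arc moved in this step, \<open>F\<close> itself serves as
      \<open>Y\<close>.\<close>
    moreover have "X \<subseteq> F" using X cross[of X] e(1) xF \<open>tail ?G e = x\<close> by auto
    ultimately show ?thesis by auto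
  next
    case False
    then have same: "tail ?G e = tail G e" "head ?G e = head G e" unfolding redirect_def by auto
    then have "X \<noteq> F" using False e by auto
    then have "X \<in> S" using X by blast
    then obtain Y where Y: "Y \<in> S" "X \<subseteq> Y" "head G e \<notin> Y" "tail G e = a Y"
      using G e unfolding anchored_def same by blast
    moreover have "Y \<noteq> F" using Y(1) F(1) by blast
    ultimately show ?thesis unfolding same by auto
  qed
  ultimately show ?thesis unfolding anchored_def by blast
qed

lemma retail_redirect:
  assumes "F \<in> L" "x \<in> F"
  shows "retail L (head G) (tail G) (tail (redirect G F x))"
  using assms unfolding retail_def redirect_def by auto

text \<open>Members are removed in an order that extends inclusion, so the arcs inside a processed member
  never change again.\<close>

lemma phase1_anchored:
  assumes "phase1 G L' G'" "laminar L" "L' \<subseteq> L" "anchored G (L - L') a"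
    and "\<And>X Y. X \<in> L - L' \<Longrightarrow> Y \<in> L' \<Longrightarrow> \<not> Y \<subset> X"
  shows "verts G' = verts G \<and> arcs G' = arcs G \<and> head G' = head G \<and>
    retail L (head G) (tail G) (tail G') \<and> (\<exists>a. anchored G' L a)"
  using assms
proof (induction arbitrary: a)
  case (stop G)
  then show ?case by (auto simp: retail_def)
next
  case (step F L' G x G')
  let ?G = "redirect G F x"
  have F: "F \<in> L" using step.hyps(1) step.prems(2) by blast
  have xF: "x \<in> F" using step.hyps(3) unfolding anchor_def by simp
  have S: "insert F (L - L') = L - (L' - {F})" using F by blast
  have "anchored ?G (insert F (L - L')) (a(F := x))"
  proof (rule anchored_redirect[OF step.prems(3) _ step.hyps(3)])
    fix X assume X: "X \<in> L - L'"
    then have "X \<subseteq> F \<or> F \<subseteq> X \<or> X \<inter> F = {}" using step.prems(1) F unfolding laminar_def by blast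
    then show "X \<subseteq> F \<or> X \<inter> F = {}" using step.prems(4)[OF X step.hyps(1)] by blast
  qed (use step.hyps(1) in blast)
  then have anch: "anchored ?G (L - (L' - {F})) (a(F := x))" unfolding S .
  have "verts G' = verts ?G \<and> arcs G' = arcs ?G \<and> head G' = head ?G \<and>
      retail L (head ?G) (tail ?G) (tail G') \<and> (\<exists>a. anchored G' L a)"
  proof (rule step.IH[OF step.prems(1) _ anch])
    show "L' - {F} \<subseteq> L" using step.prems(2) by blast
    show "\<not> Y \<subset> X" if "X \<in> L - (L' - {F})" "Y \<in> L' - {F}" for X Y
      using that step.prems(4)[of X Y] step.hyps(2) by blast
  qed
  moreover have "verts ?G = verts G" "arcs ?G = arcs G" "head ?G = head G"
    unfolding redirect_def by simp_all
  moreover note retail_trans[OF step.prems(1) retail_redirect[OF F xF]]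
  ultimately show ?case by metis
qed

section \<open>The two inequalities\<close>

theorem theorem5:
  fixes D D' :: "('a, 'b) pre_digraph" and L :: "'a set set"
  assumes "fin_digraph D"
    and "L \<subseteq> Pow (verts D)" and "laminar L" and "verts D \<in> L"
    and "phase1 D L D'"
  shows "best D' L = \<gamma> D L"
proof (rule antisym)
  interpret fin_digraph D by fact
  note L = assms(2-4)
  \<comment> \<open>No member has been treated yet, so any anchor function will do.\<close>
  have "anchored D (L - L) undefined" unfolding anchored_def by simp
  from phase1_anchored[OF assms(5) L(2) order_refl this]
  obtain a where D': "verts D' = verts D" "arcs D' = arcs D" "head D' = head D"
    and D'_retail: "retail L (head D) (tail D) (tail D')" and anch: "anchored D' L a"
    by auto
  have "finite (\<Union>L)" by (rule finite_subset[OF _ finite_verts]) (use L(1) in blast)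
  then have "finite L" by (rule finite_UnionD)
  note \<gamma>_eq = \<gamma>_eq[OF L(1)]
  have roots_eq: "roots L (head D) E t X = roots L (head D) E (tail D) X"
    if "X \<in> L" "retail L (head D) (tail D) t" for X E t
    by (rule roots_retail[OF \<open>finite L\<close> L(2) that])
  have upper: "\<gamma> D L \<le> \<mu> (G \<restriction> X)"
    if X: "X \<in> L" and G: "arcs G = arcs D" "head G = head D" "retail L (head D) (tail D) (tail G)" for G X
  proof -
    have "\<gamma> D L \<le> enat (\<rho> (G \<restriction> X) Z1 + \<rho> (G \<restriction> X) Z2)"
      if Z: "Z1 \<noteq> {}" "Z1 \<subset> X" "Z2 \<noteq> {}" "Z2 \<subset> X" "Z1 \<inter> Z2 = {}" for Z1 Z2
    proof -
      \<comment> \<open>A tight arborescence avoiding these arcs would survive the change of tails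
        and the restriction to \<open>X\<close>, yet enter neither \<open>Z1\<close> nor
        \<open>Z2\<close>.\<close>
      let ?H = "entering (G \<restriction> X) Z1 \<union> entering (G \<restriction> X) Z2"
      have H: "?H \<subseteq> arcs D" unfolding entering_def using G(1) by auto
      have "roots L (head D) (arcs D - ?H) (tail D) (verts D) = {}"
      proof (rule ccontr)
        assume "roots L (head D) (arcs D - ?H) (tail D) (verts D) \<noteq> {}"
        then obtain B r where B: "B \<subseteq> arcs D - ?H" "tight_arb L (head D) (tail D) (verts D) B r"
          unfolding roots_def by blast
        have "tight_arb L (head D) (tail G) (verts D) B r"
          by (rule tight_arb_retail[OF B(2) \<open>finite L\<close> L(2,3) G(3)])
        moreover have "X \<subseteq> verts D" "X \<noteq> {}" using L(1) X Z(1,2) by auto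
        ultimately obtain r' where
          T: "tight_arb L (head D) (tail G) X {e \<in> B. tail G e \<in> X \<and> head D e \<in> X} r'"
          by (rule tight_arb_restrict[OF _ X])
        show False
          using tight_arb_no_disjoint_closed[OF T Z(1,3) _ _ Z(5)] Z(2,4) B(1) G(1,2)
          by (auto simp: entering_def)
      qed
      then have "\<gamma> D L \<le> enat (card ?H)" unfolding \<gamma>_eq using H by (intro INF_lower) simp
      also have "\<dots> \<le> enat (\<rho> (G \<restriction> X) Z1 + \<rho> (G \<restriction> X) Z2)"
        unfolding \<rho>_def by (simp add: card_Un_le)
      finally show ?thesis .
    qed
    then show ?thesis unfolding \<mu>_def by (intro INF_greatest) auto
  qed
  have "retail L (head D) (tail D') (tail (redirect_all D' L v))" for v
    unfolding retail_def redirect_all_def using D'(3) by auto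
  then have D_v_retail: "retail L (head D) (tail D) (tail (redirect_all D' L v))" for v
    by (rule retail_trans[OF L(2) D'_retail])
  show "\<gamma> D L \<le> best D' L"
    unfolding best_def
  proof (intro INF_greatest min.boundedI)
    fix X v assume "X \<in> L"
    show "\<gamma> D L \<le> \<mu> (D' \<restriction> X)" by (rule upper[OF \<open>X \<in> L\<close> D'(2,3) D'_retail])
    show "\<gamma> D L \<le> \<mu> (redirect_all D' L v \<restriction> X)"
      by (rule upper[OF \<open>X \<in> L\<close> _ _ D_v_retail]) (simp_all add: redirect_all_def D')
  qed
  show "best D' L \<le> \<gamma> D L"
    unfolding \<gamma>_eq
  proof (rule INF_greatest, rule ccontr)
    fix H assume H: "H \<in> {H. H \<subseteq> arcs D \<and> roots L (head D) (arcs D - H) (tail D) (verts D) = {}}"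
      and "\<not> best D' L \<le> enat (card H)"
    then have less: "enat (card H) < best D' L" by simp
    have "finite H" using H finite_arcs by (auto intro: finite_subset)
    have best_le: "best D' L \<le> \<mu> (D' \<restriction> X)" if "X \<in> L" for X
      unfolding best_def by (rule INF_lower2[OF that]) simp
    have best_le': "best D' L \<le> \<mu> (redirect_all D' L v \<restriction> X)" if "X \<in> L" "v \<in> X" for X v
      unfolding best_def by (rule INF_lower2[OF that(1)]) (simp add: INF_lower2[OF that(2)] min.coboundedI2)
    interpret anchored_tails L "head D" "arcs D - H" "tail D'" a
    proof
      show "a X \<in> X" if "X \<in> L" for X using anch that unfolding anchored_def anchor_def by simp
      show "\<exists>Y\<in>L. X \<subseteq> Y \<and> head D e \<notin> Y \<and> tail D' e = a Y"
        if "X \<in> L" "tail D' e \<in> X" "head D e \<notin> X" for X e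
        using anch that D'(3) unfolding anchored_def by simp
    qed (use \<open>finite (\<Union>L)\<close> L(2) in auto)
    have "roots L (head D) (arcs D - H) (tail D') (verts D) \<noteq> {}"
    proof (rule roots_nonempty)
      show "\<not> disjoint_closed (head D) (arcs D - H) (tail D') X" if "X \<in> L" for X
        using \<mu>_le_if_disjoint_closed[OF \<open>finite H\<close>, of D' X] best_le[OF that] less D'
        by (metis leD order_trans)
      show "\<not> disjoint_closed (head D) (arcs D - H)
          (\<lambda>e. if \<exists>Y\<in>L. v \<in> Y \<and> tail D' e \<in> Y \<and> head D e \<notin> Y then v else tail D' e) X"
        if "X \<in> L" "v \<in> X" for X v
      proof
        assume "disjoint_closed (head D) (arcs D - H)
          (\<lambda>e. if \<exists>Y\<in>L. v \<in> Y \<and> tail D' e \<in> Y \<and> head D e \<notin> Y then v else tail D' e) X"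
        then have "\<mu> (redirect_all D' L v \<restriction> X) \<le> enat (card H)"
          using \<open>finite H\<close> by (intro \<mu>_le_if_disjoint_closed) (simp_all add: redirect_all_def D')
        then show False using best_le'[OF that] less by (metis leD order_trans)
      qed
      show "a X \<in> Z1 \<or> a Y \<in> Z2"
        if X: "X \<in> L" "closed_in (head D) (arcs D - H) (tail D') X Z1"
          and Y: "Y \<in> L" "closed_in (head D) (arcs D - H) (tail D') Y Z2" and disj: "Z1 \<inter> Z2 = {}"
        for X Y Z1 Z2
      proof (rule ccontr)
        assume no: "\<not> (a X \<in> Z1 \<or> a Y \<in> Z2)"
        \<comment> \<open>An anchor outside \<open>Z\<close> gives
          \<open>2 * \<rho> \<ge> \<mu> \<ge> best > card H\<close>; two such disjoint cuts do not
          fit into \<open>H\<close>.\<close>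
        have large: "card H < 2 * \<rho> (D' \<restriction> U) Z"
          if "U \<in> L" "closed_in (head D) (arcs D - H) (tail D') U Z" "a U \<notin> Z" for U Z
        proof -
          have "Z \<noteq> {} \<and> Z \<subseteq> verts (D' \<restriction> U) - {a U}" using that unfolding closed_in_def by auto
          then have "\<mu> (D' \<restriction> U) \<le> 2 * enat (\<rho> (D' \<restriction> U) Z)"
            using anch that(1) unfolding anchored_def anchor_def by blast
          then have "enat (card H) < 2 * enat (\<rho> (D' \<restriction> U) Z)"
            using best_le[OF that(1)] less by (meson less_le_trans)
          then show ?thesis by (simp add: numeral_eq_enat)
        qed
        have "\<rho> (D' \<restriction> X) Z1 + \<rho> (D' \<restriction> Y) Z2 \<le> card H"
          by (rule sum_\<rho>_le_if_closed[OF \<open>finite H\<close>]) (use X Y disj in \<open>simp_all add: D'\<close>)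
        then show False using large[OF X] large[OF Y] no by simp
      qed
    qed (rule L(3))
    then show False using H roots_eq[OF L(3) D'_retail] by simp
  qed
qed

end
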